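(* Let $\varepsilon > 0$ be fixed. For all real $x \geq 1$ and all integers $q \geq 1$ with $q \leq x$, we have $$T(x;q) - \frac{1}{\varphi(q)} \left( \sum_{\substack{1 \leq n \leq x \\ \gcd(n,q)=1}} |\mu(n)| \right)^2 \ll x^{\varepsilon} \left( x^{1/2} q^{1/2} + \frac{x}{q^{1/2}} \right).$$
   Context: Here $\mu$ is the Möbius function, $\varphi$ is Euler's totient function, and $$T(x;q) = \sum_{\substack{1 \leq n_1, n_2 \leq x \\ \gcd(n_1 n_2, q) = 1 \\ n_1 \equiv n_2 \ (\mathrm{mod}\ q)}} |\mu(n_1)| |\mu(n_2)|,$$ the sum being over pairs of integers $(n_1,n_2)$. The notation $A \ll B$ means that $|A| \leq C B$ for some constant $C > 0$ depending only on $\varepsilon$ (in particular, independent of $x$ and $q$). *)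

theory Defs
  imports "HOL-Number_Theory.Number_Theory" "HOL-Computational_Algebra.Squarefree"
begin

definition moebius_mu :: "nat \<Rightarrow> int" where
  "moebius_mu n = (if squarefree n then (-1) ^ card (prime_factors n) else 0)"

definition T :: "real \<Rightarrow> nat \<Rightarrow> real" where
  "T x q = (\<Sum>(n1, n2) \<in> {(n1 :: nat, n2 :: nat).
       1 \<le> n1 \<and> real n1 \<le> x \<and> 1 \<le> n2 \<and> real n2 \<le> x \<and>
       gcd (n1 * n2) q = 1 \<and> [n1 = n2] (mod q)}.
     real_of_int (\<bar>moebius_mu n1\<bar> * \<bar>moebius_mu n2\<bar>))"

end

theory Submission
  imports Defs "HOL-Analysis.Analysis" "HOL-Library.Discrete_Functions"
begin

text \<open>
  Let \<open>A a\<close> be the number of squarefree \<open>n \<le> x\<close> with \<open>n \<equiv> a\<close> modulo \<open>q\<close>. The quantity to be bounded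
  is the variance of \<open>A\<close> over the units modulo \<open>q\<close>, hence at most the sum of \<open>(A a - c)\<^sup>2\<close> for every
  constant \<open>c\<close>. Expand \<open>\<bar>\<mu> n\<bar>\<close> as the sum of \<open>\<mu> d\<close> over \<open>d\<^sup>2\<close> dividing \<open>n\<close>, write \<open>n = d\<^sup>2 * m\<close>, and split
  according to whether \<open>d\<^sup>2 * sqrt q \<le> x\<close>.

  Large \<open>d\<close>: here \<open>m < sqrt q\<close>, and the second moment, without subtracting any mean, is bounded by
  counting solutions of \<open>m * d\<^sup>2 \<equiv> m' * d'\<^sup>2\<close> in dyadic boxes.

  Small \<open>d\<close>: the mean is subtracted and the sum extended to all residues, so that Parseval on \<open>\<int>/q\<int>\<close>
  applies. The geometric sum over \<open>m\<close> at frequency \<open>k\<close> is at most \<open>min (x / d\<^sup>2) (q / h)\<close> for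
  \<open>h \<equiv> \<plusminus> k * d\<^sup>2\<close>, and after dyadic localisation of \<open>d\<close> and \<open>h\<close> one counts solutions of
  \<open>h * d'\<^sup>2 \<equiv> h' * d\<^sup>2\<close>, which is the same problem.

  For \<open>h, h' \<le> X\<close> and \<open>d, d' \<le> Y\<close> Cauchy-Schwarz bounds this count by \<open>x powr \<epsilon>\<close> times
  \<open>(X + X\<^sup>2 / sqrt q) * (Y + Y\<^sup>2 / sqrt q)\<close>, and each of the four resulting terms is acceptable in both ranges.
\<close>

section \<open>The divisor bound and the Moebius function\<close>

lemma divisors_mult_subset:
  fixes m n :: nat
  shows "{d. d dvd m * n} \<subseteq> (\<lambda>(a, b). a * b) ` ({a. a dvd m} \<times> {b. b dvd n})"
  by (auto elim!: dvd_productE)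

lemma card_divisors_mult_le:
  fixes m n :: nat
  assumes "m > 0" "n > 0"
  shows "card {d. d dvd m * n} \<le> card {d. d dvd m} * card {d. d dvd n}"
proof -
  have "card {d. d dvd m * n} \<le> card ((\<lambda>(a, b). a * b) ` ({a. a dvd m} \<times> {b. b dvd n}))"
    by (intro card_mono divisors_mult_subset) (use assms in auto)
  also have "\<dots> \<le> card ({a. a dvd m} \<times> {b. b dvd n})"
    by (intro card_image_le) (use assms in auto)
  finally show ?thesis by (simp add: card_cartesian_product)
qed

lemma card_divisors_prime_power:
  fixes p :: nat
  assumes "prime p"
  shows "card {d. d dvd p ^ k} = k + 1"
proof -
  have "{d. d dvd p ^ k} = (\<lambda>i. p ^ i) ` {..k}"
    using assms by (auto simp: divides_primepow_nat)
  moreover have "inj_on (\<lambda>i. p ^ i) {..k}"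
    using assms prime_gt_1_nat by (auto simp: inj_on_def)
  ultimately show ?thesis by (simp add: card_image)
qed

text \<open>Submultiplicativity of the divisor count splits off one prime power at a time, and
  \<open>p ^ k\<close> has exactly \<open>k + 1\<close> divisors.\<close>

lemma card_divisors_le_prod:
  fixes n :: nat
  assumes "n > 0"
  shows "card {d. d dvd n} \<le> (\<Prod>p\<in>prime_factors n. multiplicity p n + 1)"
proof -
  have *: "card {d. d dvd (\<Prod>p\<in>A. p ^ e p)} \<le> (\<Prod>p\<in>A. e p + 1)"
    if "finite A" "\<And>p. p \<in> A \<Longrightarrow> prime p" for A :: "nat set" and e :: "nat \<Rightarrow> nat"
    using that
  proof (induction A rule: finite_induct)
    case (insert p A)
    have pos: "p ^ e p > 0" "(\<Prod>p\<in>A. p ^ e p) > 0"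
      using insert.prems by (auto simp: prime_gt_0_nat intro!: prod_pos)
    have "card {d. d dvd (\<Prod>p\<in>insert p A. p ^ e p)}
        \<le> card {d. d dvd p ^ e p} * card {d. d dvd (\<Prod>p\<in>A. p ^ e p)}"
      using card_divisors_mult_le[OF pos] insert.hyps by simp
    also have "\<dots> \<le> (e p + 1) * (\<Prod>p\<in>A. e p + 1)"
      using insert by (intro mult_mono) (auto simp: card_divisors_prime_power)
    finally show ?case using insert.hyps by simp
  qed auto
  have "n = (\<Prod>p\<in>prime_factors n. p ^ multiplicity p n)"
    using assms by (simp add: prime_factorization_nat)
  thus ?thesis using *[of "prime_factors n" "\<lambda>p. multiplicity p n"] by auto
qed

text \<open>Since \<open>exp t \<ge> 1 + t\<close> and \<open>ln 2 \<ge> 1/2\<close>, the power is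
  at least \<open>1 + \<delta> * k / 2\<close>; the constant makes the product dominate
  \<open>k + 1\<close>. This serves both the small primes in the divisor bound and the number of
  dyadic blocks.\<close>

lemma Suc_le_const_mult_powr:
  fixes \<delta> :: real
  assumes "\<delta> > 0"
  shows "real (k + 1) \<le> (1 + 2 / \<delta>) * 2 powr (\<delta> * k)"
proof -
  have "ln 2 \<ge> (1/2 :: real)" using ln2_ge_two_thirds by simp
  have "1 + \<delta> * k * ln 2 \<le> exp (\<delta> * k * ln 2)" by (rule exp_ge_add_one_self)
  moreover have "\<delta> * k / 2 \<le> \<delta> * k * ln 2"
    using mult_left_mono[OF \<open>ln 2 \<ge> 1/2\<close>, of "\<delta> * k"] assms by simp
  ultimately have "1 + \<delta> * k / 2 \<le> exp (\<delta> * k * ln 2)" by linarith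
  hence 1: "1 + \<delta> * k / 2 \<le> 2 powr (\<delta> * k)" by (simp add: powr_def)
  have "real (k + 1) \<le> (1 + 2 / \<delta>) * (1 + \<delta> * k / 2)"
    using assms by (simp add: field_simps)
  also have "\<dots> \<le> (1 + 2 / \<delta>) * 2 powr (\<delta> * k)"
    using 1 assms by (intro mult_left_mono) auto
  finally show ?thesis .
qed

text \<open>Primes above \<open>2 powr (1 / \<delta>)\<close> satisfy \<open>k + 1 \<le> 2 ^ k \<le> p powr (\<delta> * k)\<close>, so only the
  boundedly many smaller ones contribute to the constant.\<close>

lemma divisor_bound:
  fixes \<delta> :: real
  assumes \<delta>: "\<delta> > 0"
  obtains C where "C \<ge> 1" "\<And>n::nat. n > 0 \<Longrightarrow> real (card {d. d dvd n}) \<le> C * real n powr \<delta>"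
proof -
  define K where "K = 1 + 2 / \<delta>"
  define N where "N = nat \<lceil>2 powr (1 / \<delta>)\<rceil>"
  have K: "K \<ge> 1" using \<delta> by (simp add: K_def)
  have local_bound: "real (k + 1) \<le> (if p \<le> N then K else 1) * real p powr (\<delta> * k)"
    if "prime p" for p k :: nat
  proof (cases "p \<le> N")
    case True
    have "real (k + 1) \<le> K * 2 powr (\<delta> * k)"
      unfolding K_def by (rule Suc_le_const_mult_powr[OF \<delta>])
    also have "\<dots> \<le> K * real p powr (\<delta> * k)"
      using K \<delta> prime_ge_2_nat[OF that] by (intro mult_left_mono powr_mono2) auto
    finally show ?thesis using True by simp
  next
    case False
    hence "2 powr (1 / \<delta>) \<le> real p" unfolding N_def by linarith
    hence "(2 powr (1 / \<delta>)) powr (\<delta> * k) \<le> real p powr (\<delta> * k)"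
      using \<delta> by (intro powr_mono2) auto
    hence "2 ^ k \<le> real p powr (\<delta> * k)"
      using \<delta> by (simp add: powr_powr powr_realpow)
    moreover have "real (k + 1) \<le> 2 ^ k"
      using less_exp[of k] by (metis Suc_eq_plus1 Suc_leI numeral_power_eq_of_nat_cancel_iff of_nat_mono)
    ultimately show ?thesis using False by simp
  qed
  show ?thesis
  proof
    show "K ^ N \<ge> 1" using K by simp
  next
    fix n :: nat assume n: "n > 0"
    let ?P = "prime_factors n" and ?m = "\<lambda>p. multiplicity p n"
    have "real (card {d. d dvd n}) \<le> real (\<Prod>p\<in>?P. ?m p + 1)"
      using card_divisors_le_prod[OF n] by (rule of_nat_mono)
    also have "\<dots> = (\<Prod>p\<in>?P. real (?m p + 1))" by simp
    also have "\<dots> \<le> (\<Prod>p\<in>?P. (if p \<le> N then K else 1) * real p powr (\<delta> * ?m p))"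
      by (intro prod_mono conjI local_bound) auto
    also have "\<dots> = (\<Prod>p\<in>?P. if p \<le> N then K else 1) * (\<Prod>p\<in>?P. real p powr (\<delta> * ?m p))"
      by (rule prod.distrib)
    also have "(\<Prod>p\<in>?P. real p powr (\<delta> * ?m p)) = (\<Prod>p\<in>?P. real (p ^ ?m p) powr \<delta>)"
      by (intro prod.cong refl)
        (auto simp: powr_realpow[symmetric] powr_powr mult.commute in_prime_factors_iff prime_gt_0_nat)
    also have "\<dots> = (\<Prod>p\<in>?P. real (p ^ ?m p)) powr \<delta>"
      by (rule prod_powr_distrib[symmetric])
    also have "(\<Prod>p\<in>?P. real (p ^ ?m p)) = real n"
      using prime_factorization_nat[OF n] by (metis of_nat_prod)
    also have "(\<Prod>p\<in>?P. if p \<le> N then K else 1) \<le> K ^ N"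
    proof -
      have "(\<Prod>p\<in>?P. if p \<le> N then K else 1) = (\<Prod>p\<in>{p\<in>?P. p \<le> N}. K)"
        by (rule prod.inter_filter[symmetric]) simp
      also have "\<dots> = K ^ card {p\<in>?P. p \<le> N}" by simp
      also have "card {p\<in>?P. p \<le> N} \<le> card {1..N}"
        by (intro card_mono) (auto simp: in_prime_factors_iff prime_ge_1_nat)
      hence "K ^ card {p\<in>?P. p \<le> N} \<le> K ^ N"
        using K by (intro power_increasing) auto
      finally show ?thesis .
    qed
    finally show "real (card {d. d dvd n}) \<le> K ^ N * real n powr \<delta>"
      by (simp add: mult_right_mono)
  qed
qed

section \<open>The Moebius function and square divisors\<close>

text \<open>Squarefree divisors correspond to sets of prime factors of \<open>s\<close>, so the sum
  is the expansion of the product of \<open>- 1 + 1\<close> over these primes, which vanishes unless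
  the product is empty.\<close>

lemma sum_moebius_mu_dvd:
  assumes "s > 0"
  shows "(\<Sum>d | d dvd s. moebius_mu d) = (if s = 1 then 1 else 0)"
proof -
  let ?P = "prime_factors s"
  have pr: "\<And>p. p \<in> ?P \<Longrightarrow> prime p" by auto
  have pf: "prime_factors (\<Prod>S) = S" if "S \<subseteq> ?P" for S
  proof -
    have "prime_factors (\<Prod>S) = (\<Union>p\<in>S. prime_factors p)"
      using that pr by (subst prime_factors_prod) (auto intro: finite_subset)
    also have "\<dots> = (\<Union>p\<in>S. {p})"
      using that pr by (intro SUP_cong) (auto simp: prime_factorization_prime)
    finally show ?thesis by simp
  qed
  have "(\<Sum>d | d dvd s. moebius_mu d) = (\<Sum>d | d dvd s \<and> squarefree d. (- 1) ^ card (prime_factors d))"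
    unfolding moebius_mu_def using assms
    by (intro sum.mono_neutral_cong_right) auto
  also have "\<dots> = (\<Sum>S\<in>Pow ?P. (- 1) ^ card S)"
  proof (rule sum.reindex_bij_witness[of _ "\<Prod>" prime_factors], goal_cases)
    case (1 d)
    hence d: "d > 0" "squarefree d" using assms by (auto intro: Nat.gr0I)
    have "d = (\<Prod>p\<in>prime_factors d. p ^ multiplicity p d)"
      by (rule prime_factorization_nat[OF d(1)])
    also have "\<dots> = \<Prod>(prime_factors d)"
      using d squarefree_factorial_semiring'[of d] by (intro prod.cong) auto
    finally show ?case ..
  next
    case (2 d)
    thus ?case using assms by (auto simp: in_prime_factors_iff intro: dvd_trans)
  next
    case (3 S)
    thus ?case using pf by auto
  next
    case (4 S)
    hence S: "S \<subseteq> ?P" "finite S" by (auto intro: finite_subset)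
    have "\<Prod>S dvd \<Prod>?P" using S by (intro prod_dvd_prod_subset) auto
    also have "\<Prod>?P dvd (\<Prod>p\<in>?P. p ^ multiplicity p s)"
      by (intro prod_dvd_prod) (auto simp: prime_factors_multiplicity)
    also have "\<dots> = s" using assms by (simp add: prime_factorization_nat[symmetric])
    finally have "\<Prod>S dvd s" .
    moreover have "squarefree (\<Prod>S)"
      using S pr by (intro squarefree_prod_coprime) (auto intro!: squarefree_prime primes_coprime)
    ultimately show ?case by simp
  qed auto
  also have "\<dots> = (\<Sum>S\<in>Pow ?P. (\<Prod>p\<in>S. - 1) * (\<Prod>p\<in>?P - S. 1))" by simp
  also have "\<dots> = (\<Prod>p\<in>?P. - 1 + 1)" by (rule prod_add[symmetric]) auto
  also have "\<dots> = (if ?P = {} then 1 else 0)" by (simp add: power_0_left)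
  also have "?P = {} \<longleftrightarrow> s = 1" using assms by (auto simp: prime_factorization_empty_iff)
  finally show ?thesis .
qed

text \<open>The \<open>d\<close> with \<open>d\<^sup>2\<close> dividing \<open>n\<close> are the
  divisors of \<open>square_part n\<close>, and \<open>n\<close> is squarefree exactly when that
  part is 1.\<close>

lemma abs_moebius_mu_eq_sum:
  assumes "n > 0"
  shows "\<bar>moebius_mu n\<bar> = (\<Sum>d | d\<^sup>2 dvd n. moebius_mu d)"
proof -
  have "squarefree n \<longleftrightarrow> square_part n = 1"
    unfolding squarefree_def dvd_square_part_iff[symmetric] by (metis dvd_refl dvd_trans nat_dvd_1_iff_1)
  moreover have "square_part n > 0" using assms square_part_0_iff[of n] by linarith
  moreover have "{d. d\<^sup>2 dvd n} = {d. d dvd square_part n}" by (simp add: dvd_square_part_iff)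
  ultimately show ?thesis using sum_moebius_mu_dvd[of "square_part n"]
    by (simp add: moebius_mu_def)
qed

lemma abs_moebius_mu_le_1: "\<bar>moebius_mu n\<bar> \<le> 1"
  by (simp add: moebius_mu_def)

section \<open>Counting in residue classes\<close>

text \<open>The endpoint is real so that lengths such as \<open>x / (real d)\<^sup>2\<close> can be
  used without rounding.\<close>

definition naturals_upto :: "real \<Rightarrow> nat set" where
  "naturals_upto X = {n. 1 \<le> n \<and> real n \<le> X}"

lemma naturals_upto_altdef: "naturals_upto X = {1..nat \<lfloor>X\<rfloor>}"
  unfolding naturals_upto_def by (auto simp: le_nat_floor) (linarith)+

lemma finite_naturals_upto [simp, intro]: "finite (naturals_upto X)"
  by (simp add: naturals_upto_altdef)

lemma card_naturals_upto_le: "X \<ge> 0 \<Longrightarrow> real (card (naturals_upto X)) \<le> X"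
  by (simp add: naturals_upto_altdef)

text \<open>Within one residue class a number is determined by its quotient by \<open>q\<close>,
  which takes at most \<open>X / q + 1\<close> values.\<close>

lemma card_le_if_cong:
  fixes X :: real
  assumes "q > 0" "X \<ge> 0" "A \<subseteq> naturals_upto X" "\<And>a b. a \<in> A \<Longrightarrow> b \<in> A \<Longrightarrow> [a = b] (mod q)"
  shows "real (card A) \<le> X / q + 1"
proof -
  have "inj_on (\<lambda>a. a div q) A"
  proof (rule inj_onI)
    fix a b assume ab: "a \<in> A" "b \<in> A" "a div q = b div q"
    moreover have "a mod q = b mod q" using assms(4)[of a b] ab by (auto simp: unique_euclidean_semiring_class.cong_def)
    ultimately show "a = b" by (metis div_mult_mod_eq)
  qed
  moreover have "(\<lambda>a. a div q) ` A \<subseteq> {..nat \<lfloor>X / q\<rfloor>}"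
  proof safe
    fix a assume "a \<in> A"
    hence "real a \<le> X" using assms(3) by (auto simp: naturals_upto_def)
    have "real (a div q) \<le> real a / q" by (rule of_nat_div_le_of_nat)
    also have "\<dots> \<le> X / q" using \<open>real a \<le> X\<close> by (simp add: divide_right_mono)
    finally show "a div q \<le> nat \<lfloor>X / q\<rfloor>" by (rule le_nat_floor)
  qed
  ultimately have "card A \<le> card {..nat \<lfloor>X / q\<rfloor>}"
    by (intro card_inj_on_le) auto
  hence "real (card A) \<le> real (nat \<lfloor>X / q\<rfloor>) + 1" by simp
  also have "real (nat \<lfloor>X / q\<rfloor>) \<le> X / q" using assms by simp
  finally show ?thesis by simp
qed

section \<open>Square roots modulo q\<close>

text \<open>With \<open>h = q div g\<close>, both \<open>g\<close> and \<open>h\<close> divide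
  \<open>a - b\<close>, hence so does their lcm. Their gcd divides
  \<open>(a + c) - (a - c) = 2 * c\<close> and is coprime to \<open>c\<close>, so it divides 2; this
  loss of 2 is the reason for doubling.\<close>

lemma cong_double_if_cong_cofactors:
  fixes a b c q :: nat
  assumes "coprime c q" "g dvd q"
    and a: "[a = c] (mod g)" "q div g dvd a + c"
    and b: "[b = c] (mod g)" "q div g dvd b + c"
  shows "[2 * a = 2 * b] (mod q)"
proof -
  define h where "h = q div g"
  define m where "m = int a - int b"
  have q: "q = g * h" using assms(2) by (simp add: h_def)
  have ga: "int g dvd int a - int c" and "int g dvd int b - int c"
    using a b by (auto simp: cong_iff_dvd_diff simp flip: cong_int_iff)
  hence "int g dvd m" unfolding m_def by (metis diff_diff_eq2 diff_add_cancel dvd_diff)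
  have ha: "int h dvd int a + int c" and "int h dvd int b + int c"
    using a b by (auto simp: h_def simp flip: of_nat_add)
  hence "int h dvd m" unfolding m_def by (metis add_diff_cancel_right dvd_diff)
  have "int (gcd g h) dvd (int a + int c) - (int a - int c)"
    by (rule dvd_diff) (use ga ha in \<open>auto intro: dvd_trans[of _ "int g"] dvd_trans[of _ "int h"]\<close>)
  hence "int (gcd g h) dvd int (2 * c)" by simp
  hence "gcd g h dvd 2 * c" by (simp only: int_dvd_int_iff)
  moreover have "coprime (gcd g h) c"
    using assms(1) by (metis q coprime_commute coprime_divisors dvd_refl dvd_triv_left gcd_dvd1 dvd_trans)
  ultimately have "gcd g h dvd 2" by (simp add: coprime_dvd_mult_left_iff)
  have "lcm (int g) (int h) dvd m" using \<open>int g dvd m\<close> \<open>int h dvd m\<close> by (rule lcm_least)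
  moreover have "gcd (int g) (int h) dvd 2"
    using \<open>gcd g h dvd 2\<close> by (metis gcd_int_int_eq int_dvd_int_iff of_nat_numeral)
  ultimately have "gcd (int g) (int h) * lcm (int g) (int h) dvd 2 * m" by (rule mult_dvd_mono[rotated])
  hence "int q dvd 2 * m" by (simp only: q of_nat_mult abs_of_nat flip: prod_gcd_lcm_int)
  thus ?thesis by (simp add: m_def cong_iff_dvd_diff right_diff_distrib flip: cong_int_iff)
qed

text \<open>If \<open>v\<^sup>2 \<equiv> v0\<^sup>2\<close> and \<open>g = gcd (v - v0) q\<close>, then \<open>q div g\<close> divides \<open>v + v0\<close>, and for each \<open>g\<close> the
  two conditions determine \<open>2 * v\<close> modulo \<open>q\<close>.\<close>

lemma card_square_roots_le:
  fixes X :: real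
  assumes "q > 0" "X \<ge> 0" "coprime c q"
  shows "real (card {v \<in> naturals_upto X. [v\<^sup>2 = c] (mod q)}) \<le> real (card {g. g dvd q}) * (2 * X / q + 1)"
    (is "real (card ?V) \<le> _")
proof (cases "?V = {}")
  case True
  show ?thesis unfolding True using assms by simp
next
  case False
  then obtain v0 where "[v0\<^sup>2 = c] (mod q)" by auto
  hence v0: "coprime v0 q" using assms(3)
    by (metis cong_imp_coprime cong_sym coprime_power_left_iff zero_neq_numeral zero_less_numeral)
  define S where "S = (\<lambda>g. {v \<in> naturals_upto X. [v = v0] (mod g) \<and> q div g dvd v + v0})"
  have S: "real (card (S g)) \<le> 2 * X / q + 1" if "g dvd q" for g
  proof -
    \<comment> \<open>Doubling is injective and puts \<open>S g\<close> into a single class modulo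
      \<open>q\<close> below \<open>2 * X\<close>.\<close>
    have "real (card ((*) 2 ` S g)) \<le> 2 * X / q + 1"
      using assms that cong_double_if_cong_cofactors[OF v0 that]
      by (intro card_le_if_cong) (auto simp: S_def naturals_upto_def)
    thus ?thesis by (subst (asm) card_image) (auto simp: inj_on_def)
  qed
  have "?V \<subseteq> (\<Union>g\<in>{g. g dvd q}. S g)"
  proof safe
    fix v assume v: "v \<in> naturals_upto X" "[v\<^sup>2 = c] (mod q)"
    \<comment> \<open>The gcd is taken over the integers because \<open>v - v0\<close> may be
      negative.\<close>
    define g where "g = nat (gcd (int v - int v0) (int q))"
    have g: "int g = gcd (int v - int v0) (int q)" by (simp add: g_def)
    have gq: "g dvd q" using g by (metis gcd_dvd2 int_dvd_int_iff)
    have "[v\<^sup>2 = v0\<^sup>2] (mod q)" using v \<open>[v0\<^sup>2 = c] (mod q)\<close> by (metis cong_sym cong_trans)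
    hence "int q dvd (int v)\<^sup>2 - (int v0)\<^sup>2"
      by (simp add: cong_iff_dvd_diff flip: cong_int_iff)
    hence "int q dvd (int v - int v0) * (int v + int v0)"
      by (simp add: power2_eq_square algebra_simps)
    \<comment> \<open>\<open>q\<close> divides both multiples of \<open>v + v0\<close>, hence also
      their gcd, which is \<open>v + v0\<close> times \<open>g\<close>.\<close>
    hence "int q dvd gcd ((int v + int v0) * (int v - int v0)) ((int v + int v0) * int q)"
      by (simp add: mult.commute)
    hence "int q dvd int g * (int v + int v0)"
      unfolding g gcd_mult_distrib_int[symmetric] by (simp add: mult.commute)
    hence "q dvd g * (v + v0)" by (metis int_dvd_int_iff of_nat_add of_nat_mult)
    hence "g * (q div g) dvd g * (v + v0)" using gq by simp
    moreover have "g > 0" using gq assms(1) by (auto intro: Nat.gr0I)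
    ultimately have "q div g dvd v + v0" by simp
    moreover have "[v = v0] (mod g)"
      using g by (metis cong_iff_dvd_diff cong_int_iff gcd_dvd1)
    ultimately show "v \<in> (\<Union>g\<in>{g. g dvd q}. S g)" using v gq by (auto simp: S_def)
  qed
  hence "card ?V \<le> card (\<Union>g\<in>{g. g dvd q}. S g)"
    by (intro card_mono) (auto simp: S_def assms)
  also have "\<dots> \<le> (\<Sum>g | g dvd q. card (S g))" by (intro card_UN_le) (auto simp: assms)
  finally have "real (card ?V) \<le> real (\<Sum>g | g dvd q. card (S g))" by (rule of_nat_mono)
  also have "\<dots> = (\<Sum>g | g dvd q. real (card (S g)))" by (rule of_nat_sum)
  also have "\<dots> \<le> (\<Sum>g | g dvd q. 2 * X / q + 1)" by (intro sum_mono S) auto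
  finally show ?thesis by simp
qed

text \<open>A pair is recovered from its product \<open>n\<close> and the divisor \<open>a\<close>
  of \<open>n\<close>, so every \<open>n\<close> has at most \<open>B\<close> preimages.\<close>

lemma card_product_preimage_le:
  fixes X B :: real
  assumes "X \<ge> 0" and B: "\<And>n. 1 \<le> n \<Longrightarrow> real n \<le> X\<^sup>2 \<Longrightarrow> real (card {d. d dvd n}) \<le> B"
  shows "real (card {(a, b). a \<in> naturals_upto X \<and> b \<in> naturals_upto X \<and> P (a * b)})
           \<le> B * real (card {n \<in> naturals_upto (X\<^sup>2). P n})"
proof -
  let ?S = "{n \<in> naturals_upto (X\<^sup>2). P n}"
  have "{(a, b). a \<in> naturals_upto X \<and> b \<in> naturals_upto X \<and> P (a * b)}
      \<subseteq> (\<lambda>(n, d). (d, n div d)) ` Sigma ?S (\<lambda>n. {d. d dvd n})"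
  proof clarify
    fix a b assume ab: "a \<in> naturals_upto X" "b \<in> naturals_upto X" "P (a * b)"
    have "real a * real b \<le> X * X"
      using ab assms(1) by (intro mult_mono) (auto simp: naturals_upto_def)
    hence "(a * b, a) \<in> Sigma ?S (\<lambda>n. {d. d dvd n})" "(a, b) = (a, a * b div a)"
      using ab by (auto simp: naturals_upto_def power2_eq_square)
    thus "(a, b) \<in> (\<lambda>(n, d). (d, n div d)) ` Sigma ?S (\<lambda>n. {d. d dvd n})" by force
  qed
  hence "card {(a, b). a \<in> naturals_upto X \<and> b \<in> naturals_upto X \<and> P (a * b)}
      \<le> card (Sigma ?S (\<lambda>n. {d. d dvd n}))"
    by (intro surj_card_le finite_SigmaI) (auto simp: naturals_upto_altdef)
  also have "\<dots> = (\<Sum>n\<in>?S. card {d. d dvd n})"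
    by (intro card_SigmaI) (auto simp: naturals_upto_altdef)
  finally have "real (card {(a, b). a \<in> naturals_upto X \<and> b \<in> naturals_upto X \<and> P (a * b)})
      \<le> real (\<Sum>n\<in>?S. card {d. d dvd n})" by (rule of_nat_mono)
  also have "\<dots> = (\<Sum>n\<in>?S. real (card {d. d dvd n}))" by (rule of_nat_sum)
  also have "\<dots> \<le> (\<Sum>n\<in>?S. B)" by (intro sum_mono B) (auto simp: naturals_upto_def)
  finally show ?thesis by (simp add: mult.commute)
qed

section \<open>Collisions and multiplicative energy\<close>

lemma card_collision_eq_sum:
  assumes "finite A" "finite B" "finite V" "f ` A \<subseteq> V"
  shows "real (card {(a, b). a \<in> A \<and> b \<in> B \<and> f a = g b})
    = (\<Sum>v\<in>V. real (card {a \<in> A. f a = v}) * real (card {b \<in> B. g b = v}))"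
proof -
  have "{(a, b). a \<in> A \<and> b \<in> B \<and> f a = g b}
      = (\<Union>v\<in>V. {a \<in> A. f a = v} \<times> {b \<in> B. g b = v})" using assms(4) by auto
  also have "card \<dots> = (\<Sum>v\<in>V. card ({a \<in> A. f a = v} \<times> {b \<in> B. g b = v}))"
    using assms by (intro card_UN_disjoint) auto
  finally show ?thesis by (simp add: card_cartesian_product)
qed

text \<open>This is Cauchy-Schwarz for the fibre sizes of \<open>f\<close> and \<open>g\<close>,
  summed over a finite set containing both images.\<close>

lemma card_collision_le:
  fixes f :: "'a \<Rightarrow> 'c" and g :: "'b \<Rightarrow> 'c"
  assumes "finite A" "finite B"
  shows "(real (card {(a, b). a \<in> A \<and> b \<in> B \<and> f a = g b}))\<^sup>2
    \<le> real (card {(a, a'). a \<in> A \<and> a' \<in> A \<and> f a = f a'}) *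
      real (card {(b, b'). b \<in> B \<and> b' \<in> B \<and> g b = g b'})"
proof -
  define V where "V = f ` A \<union> g ` B"
  have V: "finite V" "f ` A \<subseteq> V" "g ` B \<subseteq> V" using assms by (auto simp: V_def)
  show ?thesis
    unfolding card_collision_eq_sum[OF assms V(1,2)] card_collision_eq_sum[OF assms(1,1) V(1,2)]
      card_collision_eq_sum[OF assms(2,2) V(1,3)] power2_eq_square[symmetric]
    by (rule Cauchy_Schwarz_ineq_sum)
qed

text \<open>There are at most \<open>X\<^sup>2\<close> choices of \<open>(a, d)\<close>; each leaves
  at most \<open>M\<close> values for the product \<open>b * c\<close>, and each value comes from at
  most \<open>B\<close> pairs. \<open>R\<close> stays abstract because it is later instantiated both
  with congruence and with congruence of squares.\<close>

lemma card_multiplicative_energy_le: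
  fixes X B M :: real
  assumes "X \<ge> 0" "B \<ge> 0" "M \<ge> 0" "A \<subseteq> naturals_upto X"
    and B: "\<And>n. 1 \<le> n \<Longrightarrow> real n \<le> X\<^sup>2 \<Longrightarrow> real (card {d. d dvd n}) \<le> B"
    and M: "\<And>a d. a \<in> A \<Longrightarrow> d \<in> A \<Longrightarrow> real (card {n \<in> naturals_upto (X\<^sup>2). R (a * d) n}) \<le> M"
    and sub: "\<And>a b c d. ((a, b), (c, d)) \<in> S \<Longrightarrow>
      a \<in> A \<and> b \<in> A \<and> c \<in> A \<and> d \<in> A \<and> R (a * d) (b * c)"
  shows "real (card S) \<le> X\<^sup>2 * (B * M)"
proof -
  let ?F = "\<lambda>(a, d). {(b, c). b \<in> naturals_upto X \<and> c \<in> naturals_upto X \<and> R (a * d) (b * c)}"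
  have fin: "finite A" using assms(4) by (rule finite_subset) auto
  have finF: "finite (?F p)" for p
    by (rule finite_subset[of _ "naturals_upto X \<times> naturals_upto X"]) auto
  have "S \<subseteq> (\<lambda>((a, d), (b, c)). ((a, b), (c, d))) ` Sigma (A \<times> A) ?F"
  proof clarify
    fix a b c d assume s: "((a, b), (c, d)) \<in> S"
    have "((a, d), (b, c)) \<in> Sigma (A \<times> A) ?F" using sub[OF s] assms(4) by auto
    thus "((a, b), (c, d)) \<in> (\<lambda>((a, d), (b, c)). ((a, b), (c, d))) ` Sigma (A \<times> A) ?F"
      by (rule rev_image_eqI) simp
  qed
  hence "card S \<le> card (Sigma (A \<times> A) ?F)"
    using fin finF by (intro surj_card_le finite_SigmaI) auto
  also have "\<dots> = (\<Sum>p\<in>A \<times> A. card (?F p))" using fin finF by (intro card_SigmaI) auto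
  finally have "real (card S) \<le> real (\<Sum>p\<in>A \<times> A. card (?F p))" by (rule of_nat_mono)
  also have "\<dots> = (\<Sum>p\<in>A \<times> A. real (card (?F p)))" by (rule of_nat_sum)
  also have "\<dots> \<le> (\<Sum>p\<in>A \<times> A. B * M)"
  proof (rule sum_mono)
    fix p assume "p \<in> A \<times> A"
    then obtain a d where p: "p = (a, d)" and ad: "a \<in> A" "d \<in> A" by blast
    have "real (card (?F p)) \<le> B * real (card {n \<in> naturals_upto (X\<^sup>2). R (a * d) n})"
      using card_product_preimage_le[OF assms(1) B, of "R (a * d)"] unfolding p by simp
    also have "\<dots> \<le> B * M" using M[OF ad] assms(2) by (rule mult_left_mono)
    finally show "real (card (?F p)) \<le> B * M" .
  qed
  also have "\<dots> = (real (card A))\<^sup>2 * (B * M)"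
    by (simp add: card_cartesian_product power2_eq_square)
  also have "real (card A) \<le> X"
    using card_mono[OF finite_naturals_upto assms(4)] card_naturals_upto_le[OF assms(1)] by linarith
  hence "(real (card A))\<^sup>2 * (B * M) \<le> X\<^sup>2 * (B * M)"
    using assms by (intro mult_right_mono power_mono) auto
  finally show ?thesis .
qed

text \<open>\<open>b'\<close> and \<open>d'\<close> are inverses of \<open>b\<close> and
  \<open>d\<close>, so this clears the denominators in \<open>a / b \<equiv> c / d\<close>; the next
  lemma restores them.\<close>

lemma cong_cross_mult:
  fixes a b c d :: nat
  assumes "[b * b' = 1] (mod q)" "[d * d' = 1] (mod q)" "[a * b' = c * d'] (mod q)"
  shows "[a * d = b * c] (mod q)"
proof -
  have "[a * d * 1 = a * d * (b * b')] (mod q)"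
    using assms(1) by (intro cong_scalar_left) (rule cong_sym)
  also have "a * d * (b * b') = a * b' * (b * d)" by (simp add: mult_ac)
  also have "[\<dots> = c * d' * (b * d)] (mod q)" using assms(3) by (rule cong_scalar_right)
  also have "c * d' * (b * d) = b * c * (d * d')" by (simp add: mult_ac)
  also have "[\<dots> = b * c * 1] (mod q)" using assms(2) by (rule cong_scalar_left)
  finally show ?thesis by simp
qed

lemma cong_cross_mult_inverse:
  fixes a b c d :: nat
  assumes "[b * b' = 1] (mod q)" "[d * d' = 1] (mod q)" "[a * d = b * c] (mod q)"
  shows "[a * b' = c * d'] (mod q)"
proof -
  have "[a * b' * 1 = a * b' * (d * d')] (mod q)"
    using assms(2) by (intro cong_scalar_left) (rule cong_sym)
  also have "a * b' * (d * d') = a * d * (b' * d')" by (simp add: mult_ac)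
  also have "[\<dots> = b * c * (b' * d')] (mod q)" using assms(3) by (rule cong_scalar_right)
  also have "b * c * (b' * d') = c * d' * (b * b')" by (simp add: mult_ac)
  also have "[\<dots> = c * d' * 1] (mod q)" using assms(1) by (rule cong_scalar_left)
  finally show ?thesis by simp
qed

text \<open>The one counting problem to which both ranges of \<open>d\<close> reduce. Pairing
  \<open>h\<close> with \<open>h'\<close> and \<open>d\<close> with \<open>d'\<close> separates the
  variables for Cauchy-Schwarz.\<close>

definition twisted_pairs :: "nat \<Rightarrow> real \<Rightarrow> real \<Rightarrow> ((nat \<times> nat) \<times> (nat \<times> nat)) set" where
  "twisted_pairs q X Y = {((h, h'), (d, d')).
     {h, h'} \<subseteq> {n \<in> naturals_upto X. coprime n q} \<and> {d, d'} \<subseteq> {n \<in> naturals_upto Y. coprime n q} \<and>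
     [h * d\<^sup>2 = h' * d'\<^sup>2] (mod q)}"

text \<open>Writing the congruence as \<open>h / h' \<equiv> (d' / d)\<^sup>2\<close>, Cauchy-Schwarz over the common value reduces
  the count to the multiplicative energies of \<open>[1, X]\<close> and of the squares of \<open>[1, Y]\<close> modulo \<open>q\<close>,
  and a multiplicative energy is controlled by the divisor function.\<close>

lemma card_twisted_pairs_le:
  fixes X Y B :: real
  assumes q: "q > 0" and X: "X \<ge> 0" and Y: "Y \<ge> 0"
    and K: "X\<^sup>2 \<le> K" "Y\<^sup>2 \<le> K" "real q \<le> K"
    and B: "\<And>n. 1 \<le> n \<Longrightarrow> real n \<le> K \<Longrightarrow> real (card {d. d dvd n}) \<le> B"
  shows "real (card (twisted_pairs q X Y))
           \<le> 2 * B\<^sup>2 * ((X + X\<^sup>2 / sqrt q) * (Y + Y\<^sup>2 / sqrt q))"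
proof -
  define U where "U = {n \<in> naturals_upto X. coprime n q}"
  define W where "W = {n \<in> naturals_upto Y. coprime n q}"
  have fin: "finite U" "finite W" by (auto simp: U_def W_def)
  have "1 \<le> real q" using q by simp
  hence "1 \<le> K" using K by linarith
  hence B1: "B \<ge> 1" using B[of 1] by simp
  have Bq: "real (card {d. d dvd q}) \<le> B" using B[of q] q K by simp
  define \<iota> where "\<iota> = (\<lambda>h. SOME h'. [h * h' = 1] (mod q))"
  have \<iota>: "[h * \<iota> h = 1] (mod q)" if "coprime h q" for h
  proof -
    have "\<exists>h'. [h * h' = 1] (mod q)" using cong_solve_coprime_nat[OF that] by simp
    thus ?thesis unfolding \<iota>_def by (rule someI_ex)
  qed
  have \<iota>2: "[h\<^sup>2 * (\<iota> h)\<^sup>2 = 1] (mod q)" if "coprime h q" for h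
    using cong_pow[OF \<iota>[OF that], of 2] by (simp add: power_mult_distrib)
  \<comment> \<open>Residues are reduced modulo \<open>q\<close> so that the congruence becomes an
    equality \<open>f a = g b\<close>. The arguments of \<open>g\<close> are swapped relative to
    \<open>f\<close> because \<open>d\<^sup>2\<close> accompanies \<open>h\<close>.\<close>
  define f where "f = (\<lambda>(h, h'). (h * \<iota> h') mod q)"
  define g where "g = (\<lambda>(d, d'). (d'\<^sup>2 * (\<iota> d)\<^sup>2) mod q)"
  have mod_eq: "a mod q = b mod q \<longleftrightarrow> [a = b] (mod q)" for a b
    by (simp add: unique_euclidean_semiring_class.cong_def)

  let ?C = "{(a, b). a \<in> U \<times> U \<and> b \<in> W \<times> W \<and> f a = g b}"
  have "?C \<subseteq> (U \<times> U) \<times> (W \<times> W)" by blast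
  moreover have "finite ((U \<times> U) \<times> (W \<times> W))" using fin by (intro finite_cartesian_product)
  ultimately have finC: "finite ?C" by (rule finite_subset)
  have "twisted_pairs q X Y \<subseteq> ?C"
    unfolding twisted_pairs_def f_def g_def U_def W_def
    by (auto simp: mod_eq intro!: cong_cross_mult_inverse[OF \<iota> \<iota>2])
  hence "card (twisted_pairs q X Y) \<le> card ?C" by (rule card_mono[OF finC])
  hence "(real (card (twisted_pairs q X Y)))\<^sup>2 \<le> (real (card ?C))\<^sup>2"
    by (intro power_mono of_nat_mono) simp_all
  also have "\<dots> \<le> real (card {(a, a'). a \<in> U \<times> U \<and> a' \<in> U \<times> U \<and> f a = f a'}) *
      real (card {(b, b'). b \<in> W \<times> W \<and> b' \<in> W \<times> W \<and> g b = g b'})"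
    using fin by (intro card_collision_le finite_cartesian_product)
  \<comment> \<open>In the first energy the product lies in one residue class. In the second only
    its square is prescribed, and the extra factor \<open>B\<close> bounds the divisors of
    \<open>q\<close> that enter the count of square roots.\<close>
  also have "\<dots> \<le> (X\<^sup>2 * (B * (X\<^sup>2 / q + 1))) * (Y\<^sup>2 * (B * (B * (2 * Y\<^sup>2 / q + 1))))"
  proof (intro mult_mono)
    show "real (card {(a, a'). a \<in> U \<times> U \<and> a' \<in> U \<times> U \<and> f a = f a'}) \<le> X\<^sup>2 * (B * (X\<^sup>2 / q + 1))"
    proof (rule card_multiplicative_energy_le[where A = U and R = "\<lambda>m n. [m = n] (mod q)"])
      fix a d
      show "real (card {n \<in> naturals_upto (X\<^sup>2). [a * d = n] (mod q)}) \<le> X\<^sup>2 / q + 1"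
        using q by (intro card_le_if_cong) (auto intro: cong_trans cong_sym)
    next
      fix a b c d
      assume "((a, b), (c, d)) \<in> {(a, a'). a \<in> U \<times> U \<and> a' \<in> U \<times> U \<and> f a = f a'}"
      thus "a \<in> U \<and> b \<in> U \<and> c \<in> U \<and> d \<in> U \<and> [a * d = b * c] (mod q)"
        using cong_cross_mult[OF \<iota> \<iota>] by (auto simp: U_def f_def mod_eq)
    qed (use X B B1 K in \<open>auto simp: U_def\<close>)
  next
    show "real (card {(b, b'). b \<in> W \<times> W \<and> b' \<in> W \<times> W \<and> g b = g b'})
        \<le> Y\<^sup>2 * (B * (B * (2 * Y\<^sup>2 / q + 1)))"
    proof (rule card_multiplicative_energy_le[where A = W and R = "\<lambda>m n. [n\<^sup>2 = m\<^sup>2] (mod q)"])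
      fix a d assume "a \<in> W" "d \<in> W"
      hence "real (card {n \<in> naturals_upto (Y\<^sup>2). [n\<^sup>2 = (a * d)\<^sup>2] (mod q)})
          \<le> real (card {g. g dvd q}) * (2 * Y\<^sup>2 / q + 1)"
        using q by (intro card_square_roots_le) (auto simp: W_def)
      also have "\<dots> \<le> B * (2 * Y\<^sup>2 / q + 1)" using Bq by (intro mult_right_mono) auto
      finally show "real (card {n \<in> naturals_upto (Y\<^sup>2). [n\<^sup>2 = (a * d)\<^sup>2] (mod q)}) \<le> B * (2 * Y\<^sup>2 / q + 1)" .
    next
      fix a b c d
      assume *: "((a, b), (c, d)) \<in> {(b, b'). b \<in> W \<times> W \<and> b' \<in> W \<times> W \<and> g b = g b'}"
      hence W: "a \<in> W" "b \<in> W" "c \<in> W" "d \<in> W"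
        and "[b\<^sup>2 * (\<iota> a)\<^sup>2 = d\<^sup>2 * (\<iota> c)\<^sup>2] (mod q)" by (auto simp: g_def mod_eq)
      hence "[b\<^sup>2 * c\<^sup>2 = a\<^sup>2 * d\<^sup>2] (mod q)" using cong_cross_mult[OF \<iota>2 \<iota>2] by (auto simp: W_def)
      thus "a \<in> W \<and> b \<in> W \<and> c \<in> W \<and> d \<in> W \<and> [(b * c)\<^sup>2 = (a * d)\<^sup>2] (mod q)"
        using W by (simp add: power_mult_distrib)
    qed (use Y B B1 K in \<open>auto simp: W_def\<close>)
  qed (use B1 in auto)
  also have "\<dots> = B ^ 3 * ((X\<^sup>2 + X ^ 4 / q) * (Y\<^sup>2 + 2 * Y ^ 4 / q))"
    by (simp add: field_simps power_numeral_reduce)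
  \<comment> \<open>The constants are enlarged so that the right-hand side is a perfect square and
    the root can be taken.\<close>
  also have "\<dots> \<le> (2 * B ^ 4) * ((X + X\<^sup>2 / sqrt q)\<^sup>2 * (2 * (Y + Y\<^sup>2 / sqrt q)\<^sup>2))"
  proof (intro mult_mono)
    have "B ^ 3 * 1 \<le> B ^ 3 * B" using B1 by (intro mult_left_mono) auto
    also have "\<dots> \<le> 2 * B ^ 4" using B1 by (simp add: power_numeral_reduce)
    finally show "B ^ 3 \<le> 2 * B ^ 4" by simp
    have *: "(Z + Z\<^sup>2 / sqrt q)\<^sup>2 = Z\<^sup>2 + Z ^ 4 / q + 2 * (Z ^ 3 / sqrt q)" for Z :: real
    proof -
      have "(Z\<^sup>2)\<^sup>2 = Z ^ 4" "Z * Z\<^sup>2 = Z ^ 3" by (simp_all add: power_numeral_reduce)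
      thus ?thesis by (simp add: power2_sum power_divide)
    qed
    show "X\<^sup>2 + X ^ 4 / q \<le> (X + X\<^sup>2 / sqrt q)\<^sup>2" unfolding * using X by simp
    show "Y\<^sup>2 + 2 * Y ^ 4 / q \<le> 2 * (Y + Y\<^sup>2 / sqrt q)\<^sup>2" unfolding * using Y by simp
  qed (use X Y B1 in auto)
  also have "\<dots> = (2 * B\<^sup>2 * ((X + X\<^sup>2 / sqrt q) * (Y + Y\<^sup>2 / sqrt q)))\<^sup>2"
    by (simp add: power_mult_distrib power_numeral_reduce mult_ac)
  finally show ?thesis
    by (rule power2_le_imp_le) (use X Y B1 in auto)
qed

section \<open>Dyadic decomposition\<close>

text \<open>Cauchy-Schwarz over the classes of \<open>\<kappa>\<close>: localising to classes costs
  only their number.\<close>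

lemma square_sum_le_fibres:
  fixes f :: "'a \<Rightarrow> real"
  assumes "finite I" "finite J" "\<kappa> ` I \<subseteq> J"
  shows "(\<Sum>i\<in>I. f i)\<^sup>2 \<le> real (card J) * (\<Sum>j\<in>J. (\<Sum>i\<in>{i \<in> I. \<kappa> i = j}. f i)\<^sup>2)"
proof -
  have "(\<Sum>i\<in>I. f i) = (\<Sum>j\<in>J. \<Sum>i\<in>{i \<in> I. \<kappa> i = j}. f i)"
    using assms by (intro sum.group[symmetric])
  thus ?thesis
    using sum_squared_le_sum_of_squares[of "\<lambda>j. \<Sum>i\<in>{i \<in> I. \<kappa> i = j}. f i" J]
    by (simp add: mult.commute)
qed

text \<open>The exponents \<open>floor_log n\<close> start at 0, hence the
  \<open>+ 1\<close>.\<close>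

definition dyadic_count :: "real \<Rightarrow> nat" where
  "dyadic_count x = floor_log (nat \<lfloor>x\<rfloor>) + 1"

lemma floor_log_less_dyadic_count:
  assumes "real n \<le> x"
  shows "floor_log n < dyadic_count x"
proof -
  have "n \<le> nat \<lfloor>x\<rfloor>" using assms by (rule le_nat_floor)
  thus ?thesis using floor_log_le_iff[of n] by (simp add: dyadic_count_def less_Suc_eq_le)
qed

lemma floor_log_eq_bounds:
  assumes "floor_log n = i" "n > 0"
  shows "2 ^ i \<le> real n" "real n \<le> 2 * 2 ^ i"
proof -
  have "2 ^ i \<le> n" using floor_log_exp2_le[OF assms(2)] assms(1) by simp
  thus "2 ^ i \<le> real n" by (metis of_nat_le_iff of_nat_numeral of_nat_power)
  have "n \<le> 2 * 2 ^ i" using floor_log_exp2_ge[of n] assms(1) by simp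
  hence "real n \<le> real (2 * 2 ^ i)" by (rule of_nat_mono)
  thus "real n \<le> 2 * 2 ^ i" by simp
qed

section \<open>The target bound and its dyadic blocks\<close>

text \<open>The bound of the theorem without the factor \<open>x powr \<epsilon>\<close>.\<close>

definition variance_bound :: "real \<Rightarrow> real \<Rightarrow> real" where
  "variance_bound x q = sqrt (x * q) + x / sqrt q"

lemma variance_bound_nonneg: "x \<ge> 0 \<Longrightarrow> q \<ge> 0 \<Longrightarrow> variance_bound x q \<ge> 0"
  by (simp add: variance_bound_def)

text \<open>The factor \<open>q\<close> turns the decreasing term \<open>x / sqrt q\<close> into
  \<open>x * sqrt q\<close>, so that both terms increase. It is used to pass from a divisor of
  \<open>q\<close> to \<open>q\<close> itself.\<close>

lemma mult_variance_bound_mono: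
  assumes "0 < q'" "q' \<le> q" "0 \<le> x"
  shows "q' * variance_bound x q' \<le> q * variance_bound x q"
proof -
  have *: "r * variance_bound x r = r * sqrt (x * r) + x * sqrt r" if "r > 0" for r
  proof -
    have "r * (x / sqrt r) = x * (r / sqrt r)" by simp
    thus ?thesis using that by (simp add: variance_bound_def distrib_left real_div_sqrt)
  qed
  show ?thesis using assms unfolding *[OF assms(1)] *[OF less_le_trans[OF assms(1,2)]]
    by (intro add_mono mult_mono mult_left_mono real_sqrt_le_mono) auto
qed

text \<open>The squared minimum is the weight of a block and the product is the bound for its
  twisted pairs. With \<open>a * D\<^sup>2 = x\<close> and \<open>b * H = q\<close>, each of the
  four terms of the product is met by a suitable bound for the minimum.\<close>

lemma dyadic_block_bound:
  fixes x q H D :: real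
  assumes q: "1 \<le> q" and H: "1 \<le> H" and D: "1 \<le> D" and D_le: "D\<^sup>2 * sqrt q \<le> x"
  shows "(min (x / D\<^sup>2) (q / H))\<^sup>2 *
           ((2 * H + (2 * H)\<^sup>2 / sqrt q) * (2 * D + (2 * D)\<^sup>2 / sqrt q))
         \<le> 32 * (q * variance_bound x q)"
proof -
  define s where "s = sqrt q"
  define a where "a = x / D\<^sup>2"
  define b where "b = q / H"
  define m where "m = min a b"
  have s: "s \<ge> 1" "s\<^sup>2 = q" using q by (auto simp: s_def)
  have "D\<^sup>2 * 1 \<le> D\<^sup>2 * s" using s by (intro mult_left_mono) auto
  hence D2x: "D\<^sup>2 \<le> x" using D_le by (simp add: s_def)
  hence x: "x > 0" using D by (smt (verit) zero_less_power)
  have pos: "a > 0" "b > 0" "m > 0" using x D q H by (auto simp: a_def b_def m_def)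
  have ab: "m \<le> a" "m \<le> b" by (auto simp: m_def)
  have aD: "a * D\<^sup>2 = x" and bH: "b * H = q" using D H by (auto simp: a_def b_def)
  have mm: "m\<^sup>2 \<le> a * b" "m\<^sup>2 \<le> b\<^sup>2"
    using ab pos by (auto simp: power2_eq_square intro: mult_mono)
  \<comment> \<open>After squaring, one factor \<open>m\<^sup>2\<close> is bounded by
    \<open>a * b\<close> and the other by \<open>b\<^sup>2\<close>; the leftover \<open>b\<close> is
    at most \<open>q\<close> because \<open>H \<ge> 1\<close>.\<close>
  have t1: "m\<^sup>2 * (H * D) \<le> q * sqrt (x * q)"
  proof -
    have "(m\<^sup>2 * (H * D))\<^sup>2 = (m\<^sup>2 * m\<^sup>2) * (H\<^sup>2 * D\<^sup>2)" by (simp add: power_mult_distrib power2_eq_square)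
    also have "\<dots> \<le> ((a * b) * b\<^sup>2) * (H\<^sup>2 * D\<^sup>2)"
      using mm pos by (intro mult_right_mono mult_mono) auto
    also have "\<dots> = (a * D\<^sup>2) * (b * H)\<^sup>2 * b" by (simp add: power_mult_distrib)
    also have "\<dots> = x * q\<^sup>2 * b" by (simp only: aD bH)
    also have "b \<le> q" using H q by (simp add: b_def divide_le_eq)
    hence "x * q\<^sup>2 * b \<le> x * q\<^sup>2 * q" using x by (intro mult_left_mono) auto
    also have "x * q\<^sup>2 * q = (q * sqrt (x * q))\<^sup>2"
      using x q by (simp add: power_mult_distrib)
    finally show ?thesis by (rule power2_le_imp_le) (use x q in auto)
  qed
  have t2: "m\<^sup>2 * (H * D\<^sup>2 / s) \<le> q * (x / s)"
  proof -
    have "m\<^sup>2 * (H * D\<^sup>2 / s) \<le> (a * b) * (H * D\<^sup>2 / s)"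
      using mm H s by (intro mult_right_mono) auto
    also have "\<dots> = (a * D\<^sup>2) * (b * H) / s" by simp
    also have "\<dots> = q * (x / s)" by (simp only: aD bH) simp
    finally show ?thesis .
  qed
  have t3: "m\<^sup>2 * (H\<^sup>2 * D / s) \<le> q * sqrt (x * q)"
  proof -
    have "m\<^sup>2 * (H\<^sup>2 * D / s) \<le> b\<^sup>2 * (H\<^sup>2 * D / s)"
      using mm D s by (intro mult_right_mono) auto
    also have "\<dots> = (b * H)\<^sup>2 * D / s" by (simp add: power_mult_distrib)
    also have "\<dots> = q * (s * D)" using s by (simp only: bH) (simp add: power2_eq_square field_simps)
    also have "s * D \<le> sqrt (x * q)"
      using D2x s q by (intro real_le_rsqrt) (simp add: power_mult_distrib mult_left_mono mult.commute)
    finally show ?thesis using q by simp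
  qed
  \<comment> \<open>This term needs the full strength of \<open>D_le\<close>, namely
    \<open>D\<^sup>2 \<le> x / sqrt q\<close>.\<close>
  have t4: "m\<^sup>2 * (H\<^sup>2 * D\<^sup>2 / s\<^sup>2) \<le> q * (x / s)"
  proof -
    have "m\<^sup>2 * (H\<^sup>2 * D\<^sup>2 / s\<^sup>2) \<le> b\<^sup>2 * (H\<^sup>2 * D\<^sup>2 / s\<^sup>2)"
      using mm by (intro mult_right_mono) auto
    also have "\<dots> = (b * H)\<^sup>2 * D\<^sup>2 / s\<^sup>2" by (simp add: power_mult_distrib)
    also have "\<dots> = q * D\<^sup>2" using q by (simp only: bH s) (simp add: power2_eq_square)
    also have "D\<^sup>2 \<le> x / s" using D_le s by (simp add: s_def field_simps)
    finally show ?thesis using q by simp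
  qed
  have "m\<^sup>2 * ((2 * H + (2 * H)\<^sup>2 / s) * (2 * D + (2 * D)\<^sup>2 / s))
      = 4 * (m\<^sup>2 * (H * D)) + 8 * (m\<^sup>2 * (H * D\<^sup>2 / s)) + 8 * (m\<^sup>2 * (H\<^sup>2 * D / s))
        + 16 * (m\<^sup>2 * (H\<^sup>2 * D\<^sup>2 / s\<^sup>2))"
    using s(1) by (simp add: field_simps power2_eq_square)
  also have "\<dots> \<le> 16 * (q * sqrt (x * q)) + 16 * (q * (x / s))
      + 16 * (q * sqrt (x * q)) + 16 * (q * (x / s))"
  proof -
    have "0 \<le> q * sqrt (x * q)" "0 \<le> q * (x / s)" using x q s by auto
    thus ?thesis using t1 t2 t3 t4 by linarith
  qed
  also have "\<dots> = 32 * (q * variance_bound x q)"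
    by (simp add: variance_bound_def s_def algebra_simps)
  finally show ?thesis by (simp add: m_def a_def b_def s_def)
qed


lemma coprime_imp_pos:
  fixes m q :: nat
  assumes "coprime m q" "q > 1"
  shows "m > 0"
  using assms by (cases m) auto

text \<open>A triple \<open>(k, d, d')\<close> is sent to the residues
  \<open>h = k * d\<^sup>2\<close>, \<open>h' = k * d'\<^sup>2\<close> and the pair
  \<open>(d', d)\<close>, swapped because \<open>h * d'\<^sup>2 \<equiv> h' * d\<^sup>2\<close>. As
  \<open>d\<close> is a unit, \<open>k\<close> is recovered from \<open>h\<close>, so the map is
  injective.\<close>

lemma card_dilations_in_block_le:
  assumes q: "q > 1" and D: "\<And>d. d \<in> D \<Longrightarrow> d > 0 \<and> coprime d q" "finite D"
  shows "(\<Sum>k | k < q \<and> coprime k q.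
            (real (card {d \<in> D. floor_log d = i \<and> floor_log (k * d\<^sup>2 mod q) = j}))\<^sup>2)
         \<le> real (card (twisted_pairs q (2 * 2 ^ j) (2 * 2 ^ i)))"
proof -
  define K where "K = {k. k < q \<and> coprime k q}"
  define R where "R = (\<lambda>k. {d \<in> D. floor_log d = i \<and> floor_log (k * d\<^sup>2 mod q) = j})"
  have fin: "finite K" "\<And>k. finite (R k)" using D(2) by (auto simp: K_def R_def)
  let ?F = "\<lambda>(k, (d, d')). ((k * d\<^sup>2 mod q, k * d'\<^sup>2 mod q), (d', d))"
  have cop: "coprime (k * d\<^sup>2 mod q) q" if "k \<in> K" "d \<in> D" for k d
    using that D q by (auto simp: K_def coprime_mod_left_iff)
  have "inj_on ?F (Sigma K (\<lambda>k. R k \<times> R k))"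
  proof (rule inj_onI)
    fix s t assume st: "s \<in> Sigma K (\<lambda>k. R k \<times> R k)" "t \<in> Sigma K (\<lambda>k. R k \<times> R k)" "?F s = ?F t"
    obtain k d d' where s: "s = (k, d, d')" by (rule prod_cases3)
    obtain l e e' where t: "t = (l, e, e')" by (rule prod_cases3)
    have e: "e = d" "e' = d'" using st by (simp_all add: s t)
    have *: "k \<in> K" "l \<in> K" "d \<in> R k" "k * d\<^sup>2 mod q = l * d\<^sup>2 mod q"
      using st by (auto simp: s t)
    hence "[k * d\<^sup>2 = l * d\<^sup>2] (mod q)" by (simp add: unique_euclidean_semiring_class.cong_def)
    moreover have "coprime (d\<^sup>2) q" using * D by (auto simp: R_def)
    ultimately have "[k = l] (mod q)" by (metis cong_mult_rcancel_nat)
    hence "k = l" using * by (auto simp: K_def intro: cong_less_modulus_unique_nat)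
    thus "s = t" using e by (simp add: s t)
  qed
  moreover have "?F ` Sigma K (\<lambda>k. R k \<times> R k) \<subseteq> twisted_pairs q (2 * 2 ^ j) (2 * 2 ^ i)"
  proof clarify
    fix k d d' assume *: "k \<in> K" "d \<in> R k" "d' \<in> R k"
    have in_upto: "k * e\<^sup>2 mod q \<in> naturals_upto (2 * 2 ^ j)" "e \<in> naturals_upto (2 * 2 ^ i)" if "e \<in> R k" for e
    proof -
      have e: "e \<in> D" "floor_log e = i" "e > 0" "floor_log (k * e\<^sup>2 mod q) = j"
        using that D by (auto simp: R_def)
      have m: "k * e\<^sup>2 mod q > 0" using cop[OF *(1) e(1)] q by (rule coprime_imp_pos)
      show "k * e\<^sup>2 mod q \<in> naturals_upto (2 * 2 ^ j)"
        using floor_log_eq_bounds(2)[OF e(4) m] m unfolding naturals_upto_def by simp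
      show "e \<in> naturals_upto (2 * 2 ^ i)"
        using floor_log_eq_bounds(2)[OF e(2,3)] e(3) unfolding naturals_upto_def by simp
    qed
    have "[k * d\<^sup>2 mod q * d'\<^sup>2 = k * d\<^sup>2 * d'\<^sup>2] (mod q)"
      by (intro cong_scalar_right) simp
    also have "k * d\<^sup>2 * d'\<^sup>2 = k * d'\<^sup>2 * d\<^sup>2" by simp
    also have "[\<dots> = k * d'\<^sup>2 mod q * d\<^sup>2] (mod q)"
      by (intro cong_scalar_right) simp
    finally show "((k * d\<^sup>2 mod q, k * d'\<^sup>2 mod q), (d', d)) \<in> twisted_pairs q (2 * 2 ^ j) (2 * 2 ^ i)"
      using * D cop in_upto by (auto simp: twisted_pairs_def R_def)
  qed
  moreover have "finite (twisted_pairs q X Y)" for X Y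
    by (rule finite_subset[of _ "(naturals_upto X \<times> naturals_upto X) \<times> (naturals_upto Y \<times> naturals_upto Y)"])
      (auto simp: twisted_pairs_def)
  ultimately have "card (Sigma K (\<lambda>k. R k \<times> R k)) \<le> card (twisted_pairs q (2 * 2 ^ j) (2 * 2 ^ i))"
    by (intro card_inj_on_le)
  moreover have "card (Sigma K (\<lambda>k. R k \<times> R k)) = (\<Sum>k\<in>K. card (R k \<times> R k))"
    using fin by (intro card_SigmaI) auto
  ultimately have "real (\<Sum>k\<in>K. card (R k \<times> R k))
      \<le> real (card (twisted_pairs q (2 * 2 ^ j) (2 * 2 ^ i)))" by (simp only: of_nat_le_iff)
  thus ?thesis by (simp add: K_def R_def card_cartesian_product power2_eq_square)
qed

text \<open>Both \<open>d\<close> and the residue \<open>k * d\<^sup>2 mod q\<close> are localised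
  dyadically. In a block the weights are at most a constant, so only the second moment of the block
  sizes remains, which counts twisted pairs.\<close>

lemma unit_dilation_sum_le:
  fixes x B :: real
  assumes q: "q > 1" "real q \<le> x" and fin: "finite D"
    and D: "\<And>d. d \<in> D \<Longrightarrow> d > 0 \<and> coprime d q \<and> (real d)\<^sup>2 * sqrt q \<le> x"
    and B: "\<And>n. 1 \<le> n \<Longrightarrow> real n \<le> 4 * x\<^sup>2 \<Longrightarrow> real (card {d. d dvd n}) \<le> B"
  shows "(\<Sum>k | k < q \<and> coprime k q.
            (\<Sum>d\<in>D. min (x / (real d)\<^sup>2) (real q / real (k * d\<^sup>2 mod q)))\<^sup>2)
         \<le> real (dyadic_count x) ^ 4 * (64 * B\<^sup>2 * (q * variance_bound x q))"
proof -
  define L where "L = dyadic_count x"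
  define K where "K = {k. k < q \<and> coprime k q}"
  define J where "J = {..<L} \<times> {..<L}"
  define w where "w = (\<lambda>k d. min (x / (real d)\<^sup>2) (real q / real (k * d\<^sup>2 mod q)))"
  define \<kappa> where "\<kappa> = (\<lambda>k d. (floor_log d, floor_log (k * d\<^sup>2 mod q)))"
  define R where "R = (\<lambda>k i j. {d \<in> D. floor_log d = i \<and> floor_log (k * d\<^sup>2 mod q) = j})"
  have R_\<kappa>: "{d \<in> D. \<kappa> k d = (i, j)} = R k i j" for k i j by (auto simp: \<kappa>_def R_def)
  have sq: "sqrt q \<ge> 1" using q by simp
  have D2x: "(real d)\<^sup>2 \<le> x" if "d \<in> D" for d
  proof -
    have "(real d)\<^sup>2 * 1 \<le> (real d)\<^sup>2 * sqrt q" using sq by (intro mult_left_mono) auto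
    moreover have "(real d)\<^sup>2 * sqrt q \<le> x" using D[OF that] by simp
    ultimately show ?thesis by linarith
  qed
  have Dx: "real d \<le> x" if "d \<in> D" for d
  proof -
    have "real d * 1 \<le> real d * real d" using D[OF that] by (intro mult_left_mono) auto
    thus ?thesis using D2x[OF that] unfolding power2_eq_square by linarith
  qed
  have x: "x > 1" using q by linarith
  have modpos: "k * d\<^sup>2 mod q > 0" if "k \<in> K" "d \<in> D" for k d
  proof -
    have "coprime (k * d\<^sup>2 mod q) q" using that D q by (auto simp: K_def coprime_mod_left_iff)
    thus ?thesis using q(1) by (rule coprime_imp_pos)
  qed
  have modx: "real (k * d\<^sup>2 mod q) \<le> x" for k d
  proof -
    have "k * d\<^sup>2 mod q < q" using q by simp
    thus ?thesis using q by linarith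
  qed
  have "1 \<le> x\<^sup>2" using x by (intro one_le_power) simp
  hence "real (card {d :: nat. d dvd 1}) \<le> B" by (intro B) auto
  hence B1: "B \<ge> 0" by (rule order_trans[OF of_nat_0_le_iff])
  have block: "(\<Sum>k\<in>K. (\<Sum>d\<in>R k i j. w k d)\<^sup>2) \<le> 64 * B\<^sup>2 * (q * variance_bound x q)"
    if "(i, j) \<in> J" for i j
  proof (cases "\<exists>k\<in>K. R k i j \<noteq> {}")
    case False
    hence "(\<Sum>k\<in>K. (\<Sum>d\<in>R k i j. w k d)\<^sup>2) = 0" by (intro sum.neutral) auto
    thus ?thesis using x B1 variance_bound_nonneg[of x q] by simp
  next
    case True
    \<comment> \<open>An actual element of the block shows that \<open>2 ^ i\<close> and
      \<open>2 ^ j\<close> inherit the size constraints on \<open>d\<close> and on the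
      residue.\<close>
    then obtain k0 d0 where k0: "k0 \<in> K" "d0 \<in> R k0 i j" by blast
    define \<mu> where "\<mu> = min (x / (2 ^ i)\<^sup>2) (real q / 2 ^ j)"
    have d0: "d0 \<in> D" "floor_log d0 = i" "d0 > 0" "floor_log (k0 * d0\<^sup>2 mod q) = j"
      using k0(2) D by (auto simp: R_def)
    have i: "(2 ^ i :: real) \<le> real d0" using floor_log_eq_bounds(1)[OF d0(2,3)] .
    have j: "(2 ^ j :: real) \<le> real (k0 * d0\<^sup>2 mod q)"
      using floor_log_eq_bounds(1)[OF d0(4) modpos[OF k0(1) d0(1)]] .
    have w_le: "0 \<le> w k d \<and> w k d \<le> \<mu>" if "k \<in> K" "d \<in> R k i j" for k d
    proof -
      have d: "d \<in> D" "floor_log d = i" "d > 0" "floor_log (k * d\<^sup>2 mod q) = j"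
        using that(2) D by (auto simp: R_def)
      have "x / (real d)\<^sup>2 \<le> x / (2 ^ i)\<^sup>2"
        using floor_log_eq_bounds(1)[OF d(2,3)] x d(3)
        by (intro divide_left_mono power_mono mult_pos_pos) auto
      moreover have "real q / real (k * d\<^sup>2 mod q) \<le> real q / 2 ^ j"
        using floor_log_eq_bounds(1)[OF d(4) modpos[OF that(1) d(1)]] modpos[OF that(1) d(1)]
        by (intro divide_left_mono mult_pos_pos) auto
      ultimately show ?thesis using x unfolding w_def \<mu>_def by (auto intro: min.mono)
    qed
    have "(\<Sum>k\<in>K. (\<Sum>d\<in>R k i j. w k d)\<^sup>2) \<le> (\<Sum>k\<in>K. (\<mu> * real (card (R k i j)))\<^sup>2)"
    proof (intro sum_mono power_mono)
      fix k assume k: "k \<in> K"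
      have "(\<Sum>d\<in>R k i j. w k d) \<le> (\<Sum>d\<in>R k i j. \<mu>)"
        using w_le[OF k] by (intro sum_mono) auto
      thus "(\<Sum>d\<in>R k i j. w k d) \<le> \<mu> * real (card (R k i j))" by (simp add: mult.commute)
      show "0 \<le> (\<Sum>d\<in>R k i j. w k d)" using w_le[OF k] by (intro sum_nonneg) auto
    qed
    also have "\<dots> = \<mu>\<^sup>2 * (\<Sum>k\<in>K. (real (card (R k i j)))\<^sup>2)"
      by (simp add: power_mult_distrib sum_distrib_left)
    finally have sum_le: "(\<Sum>k\<in>K. (\<Sum>d\<in>R k i j. w k d)\<^sup>2)
        \<le> \<mu>\<^sup>2 * (\<Sum>k\<in>K. (real (card (R k i j)))\<^sup>2)" .
    have "(\<Sum>k\<in>K. (real (card (R k i j)))\<^sup>2)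
        \<le> real (card (twisted_pairs q (2 * 2 ^ j) (2 * 2 ^ i)))"
      unfolding K_def R_def using q D fin by (intro card_dilations_in_block_le) auto
    also have "\<dots> \<le> 2 * B\<^sup>2 * ((2 * 2 ^ j + (2 * 2 ^ j)\<^sup>2 / sqrt q) * (2 * 2 ^ i + (2 * 2 ^ i)\<^sup>2 / sqrt q))"
    \<comment> \<open>Block endpoints are at most \<open>2 * x\<close>, which explains the range
      \<open>4 * x\<^sup>2\<close> for the divisor bound.\<close>
    proof (rule card_twisted_pairs_le[OF _ _ _ _ _ _ B])
      have "(2 ^ j :: real) \<le> x" using j modx[of k0 d0] by linarith
      hence "(2 * 2 ^ j :: real)\<^sup>2 \<le> (2 * x)\<^sup>2" by (intro power_mono) auto
      thus "(2 * 2 ^ j :: real)\<^sup>2 \<le> 4 * x\<^sup>2" by (simp add: power_mult_distrib)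
      have "(2 ^ i :: real) \<le> x" using i Dx[OF d0(1)] by linarith
      hence "(2 * 2 ^ i :: real)\<^sup>2 \<le> (2 * x)\<^sup>2" by (intro power_mono) auto
      thus "(2 * 2 ^ i :: real)\<^sup>2 \<le> 4 * x\<^sup>2" by (simp add: power_mult_distrib)
      have "x * 1 \<le> x * x" using x by (intro mult_left_mono) auto
      thus "real q \<le> 4 * x\<^sup>2" using q x unfolding power2_eq_square by linarith
    qed (use q in auto)
    finally have "(\<Sum>k\<in>K. (\<Sum>d\<in>R k i j. w k d)\<^sup>2) \<le> \<mu>\<^sup>2 * (2 * B\<^sup>2 *
        ((2 * 2 ^ j + (2 * 2 ^ j)\<^sup>2 / sqrt q) * (2 * 2 ^ i + (2 * 2 ^ i)\<^sup>2 / sqrt q)))"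
      by (intro order_trans[OF sum_le] mult_left_mono) auto
    hence "(\<Sum>k\<in>K. (\<Sum>d\<in>R k i j. w k d)\<^sup>2) \<le> 2 * B\<^sup>2 *
        (\<mu>\<^sup>2 * ((2 * 2 ^ j + (2 * 2 ^ j)\<^sup>2 / sqrt q) * (2 * 2 ^ i + (2 * 2 ^ i)\<^sup>2 / sqrt q)))"
      by (simp only: mult_ac)
    also have "\<dots> \<le> 2 * B\<^sup>2 * (32 * (q * variance_bound x q))"
    proof (intro mult_left_mono)
      have "(2 ^ i)\<^sup>2 * sqrt q \<le> (real d0)\<^sup>2 * sqrt q"
        using i by (intro mult_right_mono power_mono) auto
      hence "(2 ^ i)\<^sup>2 * sqrt q \<le> x" using D[OF d0(1)] by linarith
      thus "\<mu>\<^sup>2 * ((2 * 2 ^ j + (2 * 2 ^ j)\<^sup>2 / sqrt q) * (2 * 2 ^ i + (2 * 2 ^ i)\<^sup>2 / sqrt q))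
          \<le> 32 * (q * variance_bound x q)"
        unfolding \<mu>_def using q by (intro dyadic_block_bound) auto
    qed auto
    finally show ?thesis by simp
  qed
  have "(\<Sum>k\<in>K. (\<Sum>d\<in>D. w k d)\<^sup>2)
      \<le> (\<Sum>k\<in>K. real (card J) * (\<Sum>p\<in>J. (\<Sum>d\<in>{d \<in> D. \<kappa> k d = p}. w k d)\<^sup>2))"
  proof (rule sum_mono)
    fix k assume "k \<in> K"
    show "(\<Sum>d\<in>D. w k d)\<^sup>2 \<le> real (card J) * (\<Sum>p\<in>J. (\<Sum>d\<in>{d \<in> D. \<kappa> k d = p}. w k d)\<^sup>2)"
      using fin Dx modx floor_log_less_dyadic_count
      by (intro square_sum_le_fibres) (auto simp: J_def L_def \<kappa>_def)
  qed
  also have "\<dots> = real (card J) * (\<Sum>p\<in>J. \<Sum>k\<in>K. (\<Sum>d\<in>{d \<in> D. \<kappa> k d = p}. w k d)\<^sup>2)"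
    by (subst sum.swap) (simp add: sum_distrib_left)
  also have "\<dots> \<le> real (card J) * (\<Sum>p\<in>J. 64 * B\<^sup>2 * (q * variance_bound x q))"
  proof (intro mult_left_mono sum_mono)
    fix p assume p: "p \<in> J"
    obtain i j where ij: "p = (i, j)" by (cases p)
    show "(\<Sum>k\<in>K. (\<Sum>d\<in>{d \<in> D. \<kappa> k d = p}. w k d)\<^sup>2) \<le> 64 * B\<^sup>2 * (q * variance_bound x q)"
      using block[of i j] p unfolding ij R_\<kappa> by simp
  qed auto
  \<comment> \<open>There are \<open>L\<^sup>2\<close> blocks: one such factor comes from
    Cauchy-Schwarz, the other from the sum over blocks.\<close>
  also have "\<dots> = real L ^ 4 * (64 * B\<^sup>2 * (q * variance_bound x q))"
    by (simp add: J_def card_cartesian_product power_numeral_reduce)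
  finally show ?thesis by (simp add: K_def w_def L_def)
qed

section \<open>Parseval and geometric sums\<close>

text \<open>Frequencies are sorted by \<open>g = gcd k q\<close>. Writing \<open>k = g * l\<close>
  and \<open>q = g * q'\<close> leaves the ratio of \<open>q\<close> to the residue unchanged, so
  each class is a sum over units modulo \<open>q'\<close>. The number of divisors \<open>g\<close>
  supplies the third factor \<open>B\<close>.\<close>

lemma dilation_sum_le:
  fixes x B :: real
  assumes q: "q > 0" "real q \<le> x" and fin: "finite D"
    and D: "\<And>d. d \<in> D \<Longrightarrow> d > 0 \<and> coprime d q \<and> (real d)\<^sup>2 * sqrt q \<le> x"
    and B: "\<And>n. 1 \<le> n \<Longrightarrow> real n \<le> 4 * x\<^sup>2 \<Longrightarrow> real (card {d. d dvd n}) \<le> B"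
  shows "(\<Sum>k\<in>{1..<q}. (\<Sum>d\<in>D. min (x / (real d)\<^sup>2) (real q / real (k * d\<^sup>2 mod q)))\<^sup>2)
         \<le> real (dyadic_count x) ^ 4 * (64 * B ^ 3 * (q * variance_bound x q))"
proof -
  define F where "F = (\<lambda>q k. (\<Sum>d\<in>D. min (x / (real d)\<^sup>2) (real q / real (k * d\<^sup>2 mod q)))\<^sup>2)"
  define L where "L = dyadic_count x"
  define V where "V = real L ^ 4 * (64 * B\<^sup>2 * (q * variance_bound x q))"
  have "1 \<le> real q" using q by simp
  hence x: "x \<ge> 1" using q by linarith
  hence "x * 1 \<le> x * x" by (intro mult_left_mono) auto
  hence "real q \<le> 4 * x\<^sup>2" using q x unfolding power2_eq_square by linarith
  hence Bq: "real (card {d. d dvd q}) \<le> B" using q by (intro B) auto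
  have V: "V \<ge> 0" using x variance_bound_nonneg[of x q] by (simp add: V_def)
  have part: "(\<Sum>k\<in>{k \<in> {1..<q}. gcd k q = g}. F q k) \<le> V" if g: "g dvd q" for g
  proof (cases "g = q")
    case True
    have "{k \<in> {1..<q}. gcd k q = g} = {}"
      using True by (auto simp: gcd_proj2_iff) (metis gcd_dvd1 dvd_imp_le less_le_not_le Suc_le_eq)
    thus ?thesis using V by (simp only: sum.empty)
  next
    case False
    define K where "K = {k \<in> {1..<q}. gcd k q = g}"
    obtain q' where q': "q = g * q'" using g by (elim dvdE)
    have pos: "g > 0" "q' > 1" using False q q' by (auto intro: Nat.gr0I simp: Suc_lessI)
    have K: "k = g * (k div g) \<and> k div g < q' \<and> coprime (k div g) q'" if "k \<in> K" for k
    proof -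
      have "gcd k q = g" "k < q" using that by (auto simp: K_def)
      then obtain l where l: "k = g * l" by (metis gcd_dvd1 dvdE)
      moreover have "l < q'" using \<open>k < q\<close> pos by (simp add: l q')
      moreover have "g * gcd l q' = g * 1"
        using \<open>gcd k q = g\<close> unfolding l q' gcd_mult_distrib_nat by simp
      hence "gcd l q' = 1" using pos by simp
      hence "coprime l q'" by (simp only: coprime_iff_gcd_eq_1)
      ultimately show ?thesis using pos by simp
    qed
    have "(\<Sum>k\<in>K. F q k) = (\<Sum>k\<in>K. F q' (k div g))"
    proof (rule sum.cong[OF refl])
      fix k assume "k \<in> K"
      from K[OF this] have "g dvd k" by (metis dvd_triv_left)
      then obtain l where l: "k = g * l" by (rule dvdE)
      have "real q / real (k * d\<^sup>2 mod q) = real q' / real (l * d\<^sup>2 mod q')" for d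
      proof -
        have "k * d\<^sup>2 mod q = g * (l * d\<^sup>2 mod q')" unfolding l q' by (simp only: mult_mod_right mult.assoc)
        thus ?thesis using pos by (simp add: q')
      qed
      thus "F q k = F q' (k div g)" using pos by (simp add: F_def l)
    qed
    also have "\<dots> = (\<Sum>l\<in>(\<lambda>k. k div g) ` K. F q' l)"
    proof -
      have "inj_on (\<lambda>k. k div g) K"
      proof (rule inj_onI)
        fix k l assume "k \<in> K" "l \<in> K" "k div g = l div g"
        thus "k = l" using K[THEN conjunct1, of k] K[THEN conjunct1, of l] by argo
      qed
      thus ?thesis by (simp only: sum.reindex o_def)
    qed
    also have "\<dots> \<le> (\<Sum>l | l < q' \<and> coprime l q'. F q' l)"
    proof (rule sum_mono2)
      show "(\<lambda>k. k div g) ` K \<subseteq> {l. l < q' \<and> coprime l q'}" using K by blast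
    qed (auto simp: F_def)
    also have "\<dots> \<le> real L ^ 4 * (64 * B\<^sup>2 * (q' * variance_bound x q'))"
      unfolding F_def L_def
    proof (rule unit_dilation_sum_le[OF pos(2) _ fin _ B])
      have le: "real q' \<le> real q" using pos by (simp add: q')
      show "real q' \<le> x" using le q by linarith
      fix d assume d: "d \<in> D"
      have "(real d)\<^sup>2 * sqrt q' \<le> (real d)\<^sup>2 * sqrt q" using le by (intro mult_left_mono) auto
      also have "\<dots> \<le> x" using D[OF d] by simp
      finally show "0 < d \<and> coprime d q' \<and> (real d)\<^sup>2 * sqrt q' \<le> x"
        using D[OF d] by (simp add: q')
    qed
    also have "\<dots> \<le> V"
      unfolding V_def using pos x by (intro mult_left_mono mult_variance_bound_mono) (auto simp: q')
    finally show ?thesis by (simp only: K_def)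
  qed
  have "(\<Sum>k\<in>{1..<q}. F q k) = (\<Sum>g\<in>{g. g dvd q}. \<Sum>k\<in>{k \<in> {1..<q}. gcd k q = g}. F q k)"
    using q by (intro sum.group[symmetric]) auto
  also have "\<dots> \<le> (\<Sum>g\<in>{g. g dvd q}. V)" by (intro sum_mono part) simp
  also have "\<dots> = real (card {g. g dvd q}) * V" by simp
  also have "\<dots> \<le> B * V" using Bq V by (rule mult_right_mono)
  also have "\<dots> = real L ^ 4 * (64 * B ^ 3 * (q * variance_bound x q))"
    by (simp add: V_def power2_eq_square power3_eq_cube)
  finally show ?thesis by (simp add: F_def L_def)
qed

lemma root_power_mod:
  fixes z :: complex
  assumes "z ^ q = 1"
  shows "z ^ (n mod q) = z ^ n"
proof -
  have "z ^ n = z ^ (q * (n div q) + n mod q)" by simp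
  also have "\<dots> = z ^ (n mod q)" by (simp only: power_add power_mult assms power_one mult_1_left)
  finally show ?thesis ..
qed

lemma cis_root_of_unity: "q > 0 \<Longrightarrow> cis (2 * pi * real k / real q) ^ q = 1"
  by (simp add: Complex.DeMoivre)

text \<open>The summand is \<open>z ^ k\<close> for a \<open>q\<close>-th root of unity
  \<open>z\<close>, which differs from 1 when \<open>a \<noteq> b\<close>; the geometric sum then
  vanishes.\<close>

lemma sum_roots_of_unity_orthogonal:
  assumes "a < q" "b < q"
  shows "(\<Sum>k<q. cis (2 * pi * real k / real q) ^ a * cnj (cis (2 * pi * real k / real q) ^ b))
         = (if a = b then of_nat q else 0)"
proof -
  define z where "z = cis (2 * pi * (real a - real b) / real q)"
  have "(\<Sum>k<q. cis (2 * pi * real k / real q) ^ a * cnj (cis (2 * pi * real k / real q) ^ b))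
      = (\<Sum>k<q. z ^ k)"
    by (intro sum.cong refl) (simp add: z_def Complex.DeMoivre cis_cnj cis_mult algebra_simps diff_divide_distrib)
  also have "\<dots> = (if a = b then of_nat q else 0)"
  proof (cases "a = b")
    case False
    have "z \<noteq> 1"
    proof
      assume "z = 1"
      hence "cos (2 * pi * (real a - real b) / real q) = 1" by (simp add: z_def complex_eq_iff)
      then obtain n :: int where "2 * pi * (real a - real b) / real q = n * 2 * pi"
        by (auto simp: cos_one_2pi_int)
      hence "2 * pi * (real a - real b) = 2 * pi * (of_int n * real q)"
        using assms by (simp add: field_simps)
      hence "real a - real b = of_int n * real q" by (simp only: mult_cancel_left) simp
      hence "real_of_int (int a - int b) = real_of_int (n * int q)" by simp
      hence n: "int a - int b = n * int q" by (simp only: of_int_eq_iff)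
      \<comment> \<open>Both \<open>a\<close> and \<open>b\<close> lie in \<open>[0, q)\<close>, so
        their difference is a multiple of \<open>q\<close> only if it is 0.\<close>
      hence "\<bar>n\<bar> * int q < 1 * int q" using assms by (auto simp flip: abs_mult[of n "int q", simplified])
      hence "n = 0" using assms by (simp only: mult_less_cancel_right) auto
      thus False using n False by simp
    qed
    moreover have "z ^ q = 1"
    proof -
      have "z ^ q = cis (2 * pi * of_int (int a - int b))"
        using assms by (simp add: z_def Complex.DeMoivre)
      thus ?thesis by (simp only: cis_multiple_2pi Ints_of_int)
    qed
    ultimately show ?thesis using False by (simp add: geometric_sum)
  qed (simp add: z_def)
  finally show ?thesis .
qed

text \<open>Parseval on the residues modulo \<open>q\<close>: the frequency 0 contributes the square
  of the total weight, and subtracting the mean removes exactly this term.\<close>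

lemma residue_variance_eq:
  fixes w :: "'i \<Rightarrow> real" and n :: "'i \<Rightarrow> nat"
  assumes fin: "finite I" and q: "q > 0"
  shows "(\<Sum>a<q. ((\<Sum>i | i \<in> I \<and> n i mod q = a. w i) - (\<Sum>i\<in>I. w i) / q)\<^sup>2)
    = (\<Sum>k\<in>{1..<q}. (cmod (\<Sum>i\<in>I. w i *\<^sub>R cis (2 * pi * real k / real q) ^ n i))\<^sup>2) / q"
proof -
  define S where "S = (\<lambda>a. \<Sum>i | i \<in> I \<and> n i mod q = a. w i)"
  define W where "W = (\<Sum>i\<in>I. w i)"
  define \<zeta> where "\<zeta> = (\<lambda>k. cis (2 * pi * real k / real q))"
  define G where "G = (\<lambda>k. \<Sum>i\<in>I. w i *\<^sub>R \<zeta> k ^ n i)"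
  have group: "(\<Sum>i\<in>I. f i) = (\<Sum>a<q. \<Sum>i | i \<in> I \<and> n i mod q = a. f i)"
    for f :: "'i \<Rightarrow> 'v :: comm_monoid_add"
    using fin q by (intro sum.group[symmetric, where ?g = "\<lambda>i. n i mod q", simplified]) auto
  have W: "W = (\<Sum>a<q. S a)" unfolding W_def S_def by (rule group)
  have G: "G k = (\<Sum>a<q. S a *\<^sub>R \<zeta> k ^ a)" for k
  proof -
    have root: "\<zeta> k ^ q = 1" unfolding \<zeta>_def using q by (rule cis_root_of_unity)
    show ?thesis unfolding G_def group[of "\<lambda>i. w i *\<^sub>R \<zeta> k ^ n i"] S_def scaleR_sum_left
      by (intro sum.cong refl) (auto simp: root_power_mod[OF root])
  qed
  have "of_real (\<Sum>k<q. (cmod (G k))\<^sup>2) = (\<Sum>k<q. G k * cnj (G k))"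
    by (simp only: of_real_sum complex_norm_square)
  also have "\<dots> = (\<Sum>k<q. \<Sum>a<q. \<Sum>b<q. of_real (S a * S b) * (\<zeta> k ^ a * cnj (\<zeta> k ^ b)))"
    unfolding G by (simp add: sum_product scaleR_conv_of_real mult_ac)
  also have "\<dots> = (\<Sum>a<q. \<Sum>k<q. \<Sum>b<q. of_real (S a * S b) * (\<zeta> k ^ a * cnj (\<zeta> k ^ b)))"
    by (rule sum.swap)
  also have "\<dots> = (\<Sum>a<q. \<Sum>b<q. \<Sum>k<q. of_real (S a * S b) * (\<zeta> k ^ a * cnj (\<zeta> k ^ b)))"
    by (intro sum.cong refl sum.swap)
  also have "\<dots> = (\<Sum>a<q. \<Sum>b<q. of_real (S a * S b) * (if a = b then of_nat q else 0))"
    unfolding sum_distrib_left[symmetric] \<zeta>_def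
    by (intro sum.cong refl arg_cong2[where f = "(*)"] sum_roots_of_unity_orthogonal) auto
  also have "\<dots> = of_real (real q * (\<Sum>a<q. (S a)\<^sup>2))"
    by (simp add: if_distrib sum.delta sum_distrib_left power2_eq_square mult_ac cong: if_cong)
  finally have parseval: "(\<Sum>k<q. (cmod (G k))\<^sup>2) = real q * (\<Sum>a<q. (S a)\<^sup>2)"
    by (simp only: of_real_eq_iff)
  have G0: "G 0 = of_real W" by (simp add: G_def \<zeta>_def W_def scaleR_conv_of_real)
  have "{..<q} = insert 0 {1..<q}" using q by auto
  hence "(\<Sum>k<q. (cmod (G k))\<^sup>2) = W\<^sup>2 + (\<Sum>k\<in>{1..<q}. (cmod (G k))\<^sup>2)"
    by (simp add: G0)
  hence main: "(\<Sum>k\<in>{1..<q}. (cmod (G k))\<^sup>2) = real q * (\<Sum>a<q. (S a)\<^sup>2) - W\<^sup>2"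
    using parseval by simp
  have "(\<Sum>a<q. (S a - W / q)\<^sup>2) = (\<Sum>a<q. (S a)\<^sup>2 - 2 * (W / q) * S a + (W / q)\<^sup>2)"
    by (intro sum.cong refl) (simp add: power2_diff)
  also have "\<dots> = (\<Sum>a<q. (S a)\<^sup>2) - 2 * (W / q) * W + real q * (W / q)\<^sup>2"
    by (simp only: sum.distrib sum_subtractf sum_distrib_left[symmetric] W) simp
  also have "\<dots> = (\<Sum>k\<in>{1..<q}. (cmod (G k))\<^sup>2) / q"
    using q unfolding main by (simp add: field_simps power2_eq_square)
  finally show ?thesis by (simp add: S_def W_def G_def \<zeta>_def)
qed

section \<open>Geometric sums of roots of unity\<close>

text \<open>A form of Jordan's inequality, weaker by a factor 2. Up to \<open>pi / 3\<close> the
  cosine is at least 1/2, so \<open>sin t - t / 2\<close> increases; beyond, \<open>sin t\<close>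
  already exceeds 1/2.\<close>

lemma sin_ge_linear:
  assumes "0 \<le> t" "t \<le> pi / 2"
  shows "t / pi \<le> sin t"
proof (cases "t \<le> pi / 3")
  case True
  have "sin 0 - 0 / 2 \<le> sin t - t / 2"
  proof (rule DERIV_nonneg_imp_nondecreasing[OF assms(1)])
    fix s :: real assume s: "0 \<le> s" "s \<le> t"
    have "cos (pi / 3) \<le> cos s" using s True by (intro cos_monotone_0_pi_le) auto
    moreover have "((\<lambda>t. sin t - t / 2) has_real_derivative (cos s - 1 / 2)) (at s)"
      by (auto intro!: derivative_eq_intros)
    ultimately show "\<exists>y. ((\<lambda>t. sin t - t / 2) has_real_derivative y) (at s) \<and> 0 \<le> y"
      by (auto simp: cos_60)
  qed
  hence "t / 2 \<le> sin t" by simp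
  moreover have "t / pi \<le> t / 2" using assms pi_gt3 by (intro divide_left_mono) auto
  ultimately show ?thesis by linarith
next
  case False
  have "sin (pi / 3) \<le> sin t" using False assms by (intro sin_monotone_2pi_le) auto
  moreover have "1 / 2 \<le> sqrt 3 / (2 :: real)" by simp
  moreover have "t / pi \<le> 1 / 2" using assms by (simp add: field_simps)
  ultimately show ?thesis unfolding sin_60 by linarith
qed

text \<open>The two terms cover the two zeros of the sine; their sum replaces the distance to the
  nearer one.\<close>

lemma inverse_sin_le:
  assumes "0 < t" "t < pi"
  shows "1 / sin t \<le> pi / t + pi / (pi - t)"
proof -
  have *: "1 / sin s \<le> pi / s" if "0 < s" "s \<le> pi / 2" for s
  proof -
    have "1 / sin s \<le> 1 / (s / pi)"
      using that sin_ge_linear[of s] by (intro divide_left_mono mult_pos_pos) (auto intro: sin_gt_zero)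
    thus ?thesis by simp
  qed
  show ?thesis
  proof (cases "t \<le> pi / 2")
    case True
    thus ?thesis using *[of t] assms by (simp add: add_increasing2)
  next
    case False
    thus ?thesis using *[of "pi - t"] assms by (simp add: add_increasing)
  qed
qed

lemma norm_one_minus_cis: "cmod (1 - cis (2 * t)) = 2 * \<bar>sin t\<bar>"
proof -
  have "(cmod (1 - cis (2 * t)))\<^sup>2 = (1 - cos (2 * t))\<^sup>2 + (sin (2 * t))\<^sup>2"
    by (simp add: cmod_power2)
  also have "\<dots> = 2 - 2 * cos (2 * t)"
    using sin_cos_squared_add[of "2 * t"] by (simp add: power2_diff)
  also have "\<dots> = (2 * \<bar>sin t\<bar>)\<^sup>2" by (simp add: cos_double_sin power_mult_distrib)
  finally show ?thesis by (subst (asm) power2_eq_iff_nonneg) auto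
qed

text \<open>Telescoping bounds the sum by \<open>2 / cmod (1 - z) = 1 / sin t\<close> with
  \<open>t = pi * h / q\<close>, uniformly in the length \<open>M\<close>.\<close>

lemma norm_geometric_cis_le:
  assumes h: "0 < h" "h < q"
  shows "cmod (\<Sum>m\<in>{1..M}. cis (2 * pi * real h / real q) ^ m)
    \<le> real q / real h + real q / real (q - h)"
proof -
  define t where "t = pi * real h / real q"
  define z where "z = cis (2 * t)"
  have t: "0 < t" "t < pi" using h by (auto simp: t_def field_simps)
  have "sin t > 0" using t by (rule sin_gt_zero)
  hence z: "cmod (1 - z) = 2 * sin t" "z \<noteq> 1" using norm_one_minus_cis[of t] by (auto simp: z_def)
  have "(\<Sum>m\<in>{1..M}. z ^ m) * (1 - z) = z * (1 - z ^ M)"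
  proof (induction M)
    case (Suc M)
    have "(\<Sum>m\<in>{1..Suc M}. z ^ m) * (1 - z) = (\<Sum>m\<in>{1..M}. z ^ m) * (1 - z) + z ^ Suc M * (1 - z)"
      by (simp add: distrib_right)
    also have "\<dots> = z * (1 - z ^ Suc M)" unfolding Suc by (simp add: algebra_simps)
    finally show ?case .
  qed simp
  hence "cmod (\<Sum>m\<in>{1..M}. z ^ m) * cmod (1 - z) = cmod (1 - z ^ M)"
    by (metis norm_mult z_def norm_cis mult_1)
  also have "\<dots> \<le> 2"
    using norm_triangle_ineq4[of 1 "z ^ M"] by (simp add: z_def norm_power)
  finally have "cmod (\<Sum>m\<in>{1..M}. z ^ m) \<le> 1 / sin t"
    using \<open>sin t > 0\<close> unfolding z by (simp add: field_simps)
  also have "\<dots> \<le> pi / t + pi / (pi - t)" using t by (rule inverse_sin_le)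
  also have "pi / t = real q / real h" using h by (simp add: t_def)
  also have "pi / (pi - t) = real q / real (q - h)"
    using h by (simp add: t_def of_nat_diff field_simps)
  finally show ?thesis by (simp add: z_def t_def mult.assoc)
qed

section \<open>Small and large square divisors\<close>

text \<open>On multiples of \<open>d\<^sup>2\<close> the frequency \<open>k\<close> acts as
  \<open>h = k * d\<^sup>2 mod q\<close>. The trivial bound and the geometric bound are combined,
  and \<open>q - h\<close> is the residue belonging to \<open>q - k\<close>, so both terms have the
  same shape.\<close>

lemma norm_weighted_dilation_sum_le:
  assumes q: "q > 0" and k: "0 < k" "k < q" and d: "coprime d q" "d > 0" and x: "x \<ge> 0"
  shows "cmod (\<Sum>m\<in>naturals_upto (x / (real d)\<^sup>2). cis (2 * pi * real k / real q) ^ (d\<^sup>2 * m))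
    \<le> min (x / (real d)\<^sup>2) (real q / real (k * d\<^sup>2 mod q))
      + min (x / (real d)\<^sup>2) (real q / real ((q - k) * d\<^sup>2 mod q))"
proof -
  define h where "h = k * d\<^sup>2 mod q"
  define y where "y = x / (real d)\<^sup>2"
  define \<omega> where "\<omega> = cis (2 * pi * real 1 / real q)"
  have "\<not> q dvd k * d\<^sup>2"
  proof
    assume "q dvd k * d\<^sup>2"
    moreover have "coprime q (d\<^sup>2)" using d by (simp add: coprime_commute)
    ultimately have "q dvd k" by (simp only: coprime_dvd_mult_left_iff)
    thus False using k by (auto dest: dvd_imp_le)
  qed
  hence h: "0 < h" "h < q" using q by (auto simp: h_def mod_greater_zero_iff_not_dvd)
  have "[(q - k) * d\<^sup>2 + k * d\<^sup>2 = 0] (mod q)"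
    using k by (simp add: cong_0_iff flip: distrib_right)
  moreover have "[(q - k) * d\<^sup>2 + k * d\<^sup>2 = (q - k) * d\<^sup>2 + h] (mod q)"
    by (intro cong_add) (auto simp: h_def cong_sym)
  ultimately have "[(q - k) * d\<^sup>2 + h = 0] (mod q)" by (metis cong_sym cong_trans)
  moreover have "[(q - h) + h = 0] (mod q)" using h by (simp add: cong_0_iff)
  ultimately have "[(q - k) * d\<^sup>2 + h = (q - h) + h] (mod q)" by (metis cong_sym cong_trans)
  hence "[(q - k) * d\<^sup>2 = q - h] (mod q)" by (simp only: cong_add_rcancel_nat)
  hence h': "(q - k) * d\<^sup>2 mod q = q - h"
    using h by (simp add: unique_euclidean_semiring_class.cong_def)
  have "cis (2 * pi * real k / real q) ^ (d\<^sup>2 * m) = cis (2 * pi * real h / real q) ^ m" for m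
  proof -
    have root: "\<omega> ^ q = 1" unfolding \<omega>_def using q by (rule cis_root_of_unity)
    have pow: "cis (2 * pi * real j / real q) = \<omega> ^ j" for j
      by (simp add: \<omega>_def Complex.DeMoivre mult_ac)
    have "\<omega> ^ h = \<omega> ^ (k * d\<^sup>2)" unfolding h_def by (rule root_power_mod[OF root])
    thus ?thesis unfolding pow by (simp add: power_mult)
  qed
  hence eq: "(\<Sum>m\<in>naturals_upto y. cis (2 * pi * real k / real q) ^ (d\<^sup>2 * m))
      = (\<Sum>m\<in>naturals_upto y. cis (2 * pi * real h / real q) ^ m)" by simp
  have "cmod (\<Sum>m\<in>naturals_upto y. cis (2 * pi * real h / real q) ^ m) \<le> real (card (naturals_upto y))"
    by (rule order_trans[OF norm_sum]) (simp add: norm_power)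
  also have "\<dots> \<le> y" using x by (intro card_naturals_upto_le) (simp add: y_def)
  finally have 1: "cmod (\<Sum>m\<in>naturals_upto y. cis (2 * pi * real h / real q) ^ m) \<le> y" .
  have 2: "cmod (\<Sum>m\<in>naturals_upto y. cis (2 * pi * real h / real q) ^ m)
      \<le> real q / real h + real q / real (q - h)"
    unfolding naturals_upto_altdef by (rule norm_geometric_cis_le[OF h])
  have min_add: "s \<le> min b u + min b v"
    if "0 \<le> b" "0 \<le> u" "0 \<le> v" "s \<le> b" "s \<le> u + v" for s b u v :: real
    using that by (auto simp: min_def)
  have "0 \<le> y" "0 \<le> real q / real h" "0 \<le> real q / real (q - h)" using x by (auto simp: y_def)
  hence "cmod (\<Sum>m\<in>naturals_upto y. cis (2 * pi * real h / real q) ^ m)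
      \<le> min y (real q / real h) + min y (real q / real (q - h))"
    using 1 2 by (rule min_add)
  thus ?thesis unfolding y_def[symmetric] h' h_def[symmetric] eq .
qed

text \<open>By Parseval the variance becomes a sum over nonzero frequencies, each bounded by
  \<open>P k + P (q - k)\<close>.\<close>

lemma variance_small_divisors_le:
  fixes x B :: real and c :: "nat \<Rightarrow> real"
  assumes q: "q > 0" "real q \<le> x" and fin: "finite D"
    and D: "\<And>d. d \<in> D \<Longrightarrow> d > 0 \<and> coprime d q \<and> (real d)\<^sup>2 * sqrt q \<le> x"
    and B: "\<And>n. 1 \<le> n \<Longrightarrow> real n \<le> 4 * x\<^sup>2 \<Longrightarrow> real (card {d. d dvd n}) \<le> B"
    and c: "\<And>d. \<bar>c d\<bar> \<le> 1"
  defines "I \<equiv> Sigma D (\<lambda>d. naturals_upto (x / (real d)\<^sup>2))"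
  shows "(\<Sum>a<q. ((\<Sum>i | i \<in> I \<and> (case i of (d, m) \<Rightarrow> d\<^sup>2 * m) mod q = a. c (fst i))
                - (\<Sum>i\<in>I. c (fst i)) / q)\<^sup>2)
         \<le> 256 * real (dyadic_count x) ^ 4 * B ^ 3 * variance_bound x q"
proof -
  define u where "u = (\<lambda>k d. min (x / (real d)\<^sup>2) (real q / real (k * d\<^sup>2 mod q)))"
  define P where "P = (\<lambda>k. \<Sum>d\<in>D. u k d)"
  define \<zeta> where "\<zeta> = (\<lambda>k. cis (2 * pi * real k / real q))"
  have x: "x \<ge> 0" using q by linarith
  have finI: "finite I" unfolding I_def using fin by (intro finite_SigmaI) auto
  have P: "cmod (\<Sum>i\<in>I. c (fst i) *\<^sub>R \<zeta> k ^ (case i of (d, m) \<Rightarrow> d\<^sup>2 * m)) \<le> P k + P (q - k)"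
    if k: "k \<in> {1..<q}" for k
  proof -
    have "(\<Sum>i\<in>I. c (fst i) *\<^sub>R \<zeta> k ^ (case i of (d, m) \<Rightarrow> d\<^sup>2 * m))
        = (\<Sum>d\<in>D. \<Sum>m\<in>naturals_upto (x / (real d)\<^sup>2). c d *\<^sub>R \<zeta> k ^ (d\<^sup>2 * m))"
      unfolding I_def using fin by (subst sum.Sigma) (auto intro!: sum.cong)
    also have "\<dots> = (\<Sum>d\<in>D. c d *\<^sub>R (\<Sum>m\<in>naturals_upto (x / (real d)\<^sup>2). \<zeta> k ^ (d\<^sup>2 * m)))"
      by (simp only: scaleR_sum_right)
    also have "cmod \<dots> \<le> (\<Sum>d\<in>D. u k d + u (q - k) d)"
    proof (rule order_trans[OF norm_sum], rule sum_mono)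
      fix d assume d: "d \<in> D"
      let ?S = "\<Sum>m\<in>naturals_upto (x / (real d)\<^sup>2). \<zeta> k ^ (d\<^sup>2 * m)"
      have "cmod (c d *\<^sub>R ?S) = \<bar>c d\<bar> * cmod ?S" by simp
      also have "\<dots> \<le> 1 * cmod ?S" using c[of d] by (intro mult_right_mono) auto
      also have "1 * cmod ?S \<le> u k d + u (q - k) d"
        unfolding u_def \<zeta>_def mult_1_left using D[OF d] q x k
        by (intro norm_weighted_dilation_sum_le) auto
      finally show "cmod (c d *\<^sub>R ?S) \<le> u k d + u (q - k) d" .
    qed
    also have "\<dots> = P k + P (q - k)" by (simp add: P_def sum.distrib)
    finally show ?thesis .
  qed
  have "(\<Sum>k\<in>{1..<q}. (cmod (\<Sum>i\<in>I. c (fst i) *\<^sub>R \<zeta> k ^ (case i of (d, m) \<Rightarrow> d\<^sup>2 * m)))\<^sup>2)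
      \<le> (\<Sum>k\<in>{1..<q}. 2 * (P k)\<^sup>2 + 2 * (P (q - k))\<^sup>2)"
  proof (rule sum_mono)
    fix k assume k: "k \<in> {1..<q}"
    have "(cmod (\<Sum>i\<in>I. c (fst i) *\<^sub>R \<zeta> k ^ (case i of (d, m) \<Rightarrow> d\<^sup>2 * m)))\<^sup>2
        \<le> (P k + P (q - k))\<^sup>2" using P[OF k] by (intro power_mono) auto
    also have "\<dots> \<le> 2 * (P k)\<^sup>2 + 2 * (P (q - k))\<^sup>2"
      using sum_squares_bound[of "P k" "P (q - k)"] by (simp add: power2_sum)
    finally show "(cmod (\<Sum>i\<in>I. c (fst i) *\<^sub>R \<zeta> k ^ (case i of (d, m) \<Rightarrow> d\<^sup>2 * m)))\<^sup>2
        \<le> 2 * (P k)\<^sup>2 + 2 * (P (q - k))\<^sup>2" .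
  qed
  also have "\<dots> = 2 * (\<Sum>k\<in>{1..<q}. (P k)\<^sup>2) + 2 * (\<Sum>k\<in>{1..<q}. (P (q - k))\<^sup>2)"
    by (simp only: sum.distrib sum_distrib_left)
  \<comment> \<open>The reflection of \<open>k\<close> to \<open>q - k\<close> permutes the nonzero
    frequencies, so both halves agree; the final constant is 4 times 64.\<close>
  also have "(\<Sum>k\<in>{1..<q}. (P (q - k))\<^sup>2) = (\<Sum>k\<in>{1..<q}. (P k)\<^sup>2)"
    by (rule sum.reindex_bij_witness[of _ "\<lambda>k. q - k" "\<lambda>k. q - k"]) auto
  also have "2 * (\<Sum>k\<in>{1..<q}. (P k)\<^sup>2) + 2 * (\<Sum>k\<in>{1..<q}. (P k)\<^sup>2)
      = 4 * (\<Sum>k\<in>{1..<q}. (P k)\<^sup>2)" by simp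
  also have "\<dots> \<le> 4 * (real (dyadic_count x) ^ 4 * (64 * B ^ 3 * (q * variance_bound x q)))"
    unfolding P_def u_def using q fin D B by (intro mult_left_mono dilation_sum_le) auto
  finally have "(\<Sum>k\<in>{1..<q}. (cmod (\<Sum>i\<in>I. c (fst i) *\<^sub>R \<zeta> k ^ (case i of (d, m) \<Rightarrow> d\<^sup>2 * m)))\<^sup>2) / q
      \<le> 4 * (real (dyadic_count x) ^ 4 * (64 * B ^ 3 * (q * variance_bound x q))) / q"
    by (intro divide_right_mono) auto
  also have "\<dots> = 256 * real (dyadic_count x) ^ 4 * B ^ 3 * variance_bound x q"
    using q by simp
  finally show ?thesis unfolding residue_variance_eq[OF finI q(1)] \<zeta>_def .
qed

section \<open>Large square divisors\<close>

text \<open>For \<open>X \<le> sqrt q\<close> the first factor is at most \<open>2 * X\<close>; then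
  \<open>X * D\<^sup>2 \<le> x\<close> handles both remaining terms.\<close>

lemma short_block_bound:
  fixes x q X D :: real
  assumes q: "1 \<le> q" and D: "1 \<le> D" and X: "0 \<le> X" "X * D\<^sup>2 \<le> x" "X \<le> sqrt q"
  shows "(X + X\<^sup>2 / sqrt q) * (2 * D + (2 * D)\<^sup>2 / sqrt q) \<le> 8 * variance_bound x q"
proof -
  define s where "s = sqrt q"
  have s: "s \<ge> 1" "s\<^sup>2 = q" "X \<le> s" using q X by (auto simp: s_def)
  have x: "0 \<le> x" using X by (meson mult_nonneg_nonneg order_trans zero_le_power2)
  have "X\<^sup>2 / s \<le> X"
    using mult_left_mono[OF s(3) X(1)] s(1) by (simp add: power2_eq_square divide_le_eq)
  hence "(X + X\<^sup>2 / s) * (2 * D + (2 * D)\<^sup>2 / s) \<le> (2 * X) * (2 * D + (2 * D)\<^sup>2 / s)"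
    using D s(1) by (intro mult_right_mono) auto
  also have "\<dots> = 4 * (X * D) + 8 * (X * D\<^sup>2 / s)" by (simp add: algebra_simps power2_eq_square)
  also have "X * D \<le> sqrt (x * q)"
  proof (rule real_le_rsqrt)
    have "(X * D)\<^sup>2 = X * (X * D\<^sup>2)" by (simp add: power2_eq_square)
    also have "\<dots> \<le> s * x" using X s x by (intro mult_mono) auto
    also have "\<dots> \<le> (s * s) * x" using s x by (intro mult_right_mono) auto
    finally show "(X * D)\<^sup>2 \<le> x * q" using s by (simp add: power2_eq_square mult.commute)
  qed
  also have "X * D\<^sup>2 / s \<le> x / s" using X s by (intro divide_right_mono) auto
  finally have "(X + X\<^sup>2 / s) * (2 * D + (2 * D)\<^sup>2 / s) \<le> 4 * sqrt (x * q) + 8 * (x / s)"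
    by simp
  also have "\<dots> \<le> 8 * variance_bound x q" using x q by (simp add: variance_bound_def s_def)
  finally show ?thesis by (simp add: s_def)
qed

text \<open>The coefficients are replaced by 1 in absolute value. In a dyadic block of
  \<open>d\<close>, the squared class sizes count pairs with
  \<open>d\<^sup>2 * m \<equiv> d'\<^sup>2 * m'\<close>, which are twisted pairs with
  \<open>m\<close> in the role of \<open>h\<close>.\<close>

lemma second_moment_large_divisors_le:
  fixes x B :: real and c :: "nat \<Rightarrow> real"
  assumes q: "q > 0" "real q \<le> x" and fin: "finite D"
    and D: "\<And>d. d \<in> D \<Longrightarrow> d > 0 \<and> coprime d q \<and> (real d)\<^sup>2 * sqrt q > x \<and> (real d)\<^sup>2 \<le> x"
    and B: "\<And>n. 1 \<le> n \<Longrightarrow> real n \<le> 4 * x\<^sup>2 \<Longrightarrow> real (card {d. d dvd n}) \<le> B"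
    and c: "\<And>d. \<bar>c d\<bar> \<le> 1"
  defines "I \<equiv> Sigma D (\<lambda>d. naturals_upto (x / (real d)\<^sup>2))"
  shows "(\<Sum>a | a < q \<and> coprime a q.
             (\<Sum>i | i \<in> I \<and> (case i of (d, m) \<Rightarrow> d\<^sup>2 * m) mod q = a. c (fst i))\<^sup>2)
         \<le> 16 * (real (dyadic_count x))\<^sup>2 * B\<^sup>2 * variance_bound x q"
proof -
  define L where "L = dyadic_count x"
  define U where "U = {a. a < q \<and> coprime a q}"
  define n where "n = (\<lambda>(d :: nat, m :: nat). d\<^sup>2 * m)"
  define R where "R = (\<lambda>a j. {i \<in> I. n i mod q = a \<and> floor_log (fst i) = j})"
  have "1 \<le> real q" using q by simp
  hence x: "x \<ge> 1" using q by linarith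
  have finI: "finite I" unfolding I_def using fin by (intro finite_SigmaI) auto
  have finU: "finite U" by (simp add: U_def)
  have Dx: "real d \<le> x" if "d \<in> D" for d
  proof -
    have "real d * 1 \<le> real d * real d" using D[OF that] by (intro mult_left_mono) auto
    thus ?thesis using D[OF that] unfolding power2_eq_square by linarith
  qed
  have block: "(\<Sum>a\<in>U. (real (card (R a j)))\<^sup>2) \<le> 16 * B\<^sup>2 * variance_bound x q" for j
  proof (cases "\<exists>a\<in>U. R a j \<noteq> {}")
    case False
    hence "(\<Sum>a\<in>U. (real (card (R a j)))\<^sup>2) = 0" by (intro sum.neutral) auto
    thus ?thesis using x variance_bound_nonneg[of x q] by simp
  next
    case True
    then obtain d0 m0 where "d0 \<in> D" "floor_log d0 = j" by (auto simp: R_def I_def)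
    hence j: "2 ^ j \<le> x" using floor_log_eq_bounds(1)[of d0 j] D[of d0] Dx[of d0] by linarith
    \<comment> \<open>Since \<open>d\<^sup>2 * sqrt q > x\<close>, the cofactor
      \<open>m \<le> x / d\<^sup>2\<close> is also bounded by \<open>sqrt q\<close>.\<close>
    define X where "X = min (x / (2 ^ j)\<^sup>2) (sqrt q)"
    define Y :: real where "Y = 2 * 2 ^ j"
    have X0: "X \<ge> 0" using x by (simp add: X_def)
    have R_upto: "fst i \<in> naturals_upto Y \<and> coprime (fst i) q \<and> snd i \<in> naturals_upto X \<and> coprime (snd i) q"
      if a: "a \<in> U" "i \<in> R a j" for a i
    proof -
      obtain d m where i: "i = (d, m)" by (cases i)
      have d: "d \<in> D" "m \<in> naturals_upto (x / (real d)\<^sup>2)" "floor_log d = j" "d\<^sup>2 * m mod q = a"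
        using a by (auto simp: R_def I_def n_def i)
      have dp: "d > 0" "coprime d q" "(real d)\<^sup>2 * sqrt q > x" using D[OF d(1)] by auto
      \<comment> \<open>The product is congruent to the unit \<open>a\<close>, which makes
        \<open>m\<close> coprime to \<open>q\<close> as well.\<close>
      have "coprime (d\<^sup>2 * m) q"
        using a(1) q unfolding d(4)[symmetric] U_def by (simp add: coprime_mod_left_iff)
      moreover have "x / (real d)\<^sup>2 \<le> sqrt q" using dp by (simp add: divide_le_eq mult.commute)
      moreover have "x / (real d)\<^sup>2 \<le> x / (2 ^ j)\<^sup>2"
        using floor_log_eq_bounds(1)[OF d(3) dp(1)] x dp(1)
        by (intro divide_left_mono power_mono mult_pos_pos) auto
      ultimately show ?thesis
        using d(2) dp floor_log_eq_bounds(2)[OF d(3) dp(1)] by (auto simp: i naturals_upto_def X_def Y_def)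
    qed
    let ?F = "\<lambda>(a :: nat, ((d, m), (d', m'))). ((m, m'), (d, d'))"
    have inj: "inj_on ?F (Sigma U (\<lambda>a. R a j \<times> R a j))"
      by (rule inj_onI) (auto simp: R_def)
    have sub: "?F ` Sigma U (\<lambda>a. R a j \<times> R a j) \<subseteq> twisted_pairs q X Y"
    proof clarify
      fix a d m d' m' assume *: "a \<in> U" "(d, m) \<in> R a j" "(d', m') \<in> R a j"
      have "[m * d\<^sup>2 = m' * d'\<^sup>2] (mod q)"
        using * by (simp add: R_def n_def unique_euclidean_semiring_class.cong_def mult.commute)
      thus "((m, m'), (d, d')) \<in> twisted_pairs q X Y"
        using R_upto[OF *(1,2)] R_upto[OF *(1,3)] by (simp add: twisted_pairs_def)
    qed
    have fin_tw: "finite (twisted_pairs q X Y)"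
      by (rule finite_subset[of _ "(naturals_upto X \<times> naturals_upto X) \<times> (naturals_upto Y \<times> naturals_upto Y)"])
        (auto simp: twisted_pairs_def)
    have finR: "finite (R a j)" for a using finI by (simp add: R_def)
    have "card (Sigma U (\<lambda>a. R a j \<times> R a j)) \<le> card (twisted_pairs q X Y)"
      by (rule card_inj_on_le[OF inj sub fin_tw])
    moreover have "card (Sigma U (\<lambda>a. R a j \<times> R a j)) = (\<Sum>a\<in>U. card (R a j \<times> R a j))"
      using finU finR by (intro card_SigmaI) auto
    ultimately have "real (\<Sum>a\<in>U. card (R a j \<times> R a j)) \<le> real (card (twisted_pairs q X Y))"
      by (simp only: of_nat_le_iff)
    also have "\<dots> \<le> 2 * B\<^sup>2 * ((X + X\<^sup>2 / sqrt q) * (Y + Y\<^sup>2 / sqrt q))"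
    proof (rule card_twisted_pairs_le[OF q(1) X0 _ _ _ _ B])
      have "x * 1 \<le> x * x" using x by (intro mult_left_mono) auto
      hence x2: "real q \<le> 4 * x\<^sup>2" using q x unfolding power2_eq_square by linarith
      show "real q \<le> 4 * x\<^sup>2" by (rule x2)
      have "X\<^sup>2 \<le> (sqrt q)\<^sup>2" using X0 by (intro power_mono) (auto simp: X_def)
      thus "X\<^sup>2 \<le> 4 * x\<^sup>2" using x2 by simp
      have "Y\<^sup>2 \<le> (2 * x)\<^sup>2" using j unfolding Y_def by (intro power_mono) auto
      thus "Y\<^sup>2 \<le> 4 * x\<^sup>2" by (simp add: power_mult_distrib)
    qed (auto simp: Y_def)
    also have "\<dots> \<le> 2 * B\<^sup>2 * (8 * variance_bound x q)"
    proof (rule mult_left_mono)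
      have "X * (2 ^ j)\<^sup>2 \<le> x / (2 ^ j)\<^sup>2 * (2 ^ j)\<^sup>2" by (intro mult_right_mono) (auto simp: X_def)
      hence "X * (2 ^ j)\<^sup>2 \<le> x" by simp
      thus "(X + X\<^sup>2 / sqrt q) * (Y + Y\<^sup>2 / sqrt q) \<le> 8 * variance_bound x q"
        unfolding Y_def using q X0 by (intro short_block_bound) (auto simp: X_def)
    qed simp
    finally show ?thesis by (simp add: card_cartesian_product power2_eq_square)
  qed
  have "(\<Sum>a\<in>U. (\<Sum>i | i \<in> I \<and> n i mod q = a. c (fst i))\<^sup>2)
      \<le> (\<Sum>a\<in>U. real L * (\<Sum>j<L. (real (card (R a j)))\<^sup>2))"
  proof (rule sum_mono)
    fix a
    let ?I = "{i. i \<in> I \<and> n i mod q = a}"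
    have "\<bar>\<Sum>i\<in>?I. c (fst i)\<bar> \<le> (\<Sum>i\<in>?I. 1)"
      by (rule order_trans[OF sum_abs sum_mono]) (rule c)
    hence "(\<Sum>i\<in>?I. c (fst i))\<^sup>2 \<le> (\<Sum>i\<in>?I. 1)\<^sup>2" by (rule power2_le_iff_abs_le[THEN iffD2, rotated]) simp
    also have "\<dots> \<le> real (card {..<L}) * (\<Sum>j\<in>{..<L}. (\<Sum>i\<in>{i \<in> ?I. floor_log (fst i) = j}. 1)\<^sup>2)"
    proof (rule square_sum_le_fibres)
      show "(\<lambda>i. floor_log (fst i)) ` ?I \<subseteq> {..<L}"
        unfolding L_def using Dx by (auto simp: I_def intro: floor_log_less_dyadic_count)
    qed (use finI in auto)
    also have "\<dots> = real L * (\<Sum>j<L. (real (card (R a j)))\<^sup>2)"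
      by (simp add: R_def conj_assoc)
    finally show "(\<Sum>i | i \<in> I \<and> n i mod q = a. c (fst i))\<^sup>2
        \<le> real L * (\<Sum>j<L. (real (card (R a j)))\<^sup>2)" .
  qed
  also have "\<dots> = real L * (\<Sum>j<L. \<Sum>a\<in>U. (real (card (R a j)))\<^sup>2)"
    by (subst sum.swap) (simp add: sum_distrib_left)
  also have "\<dots> \<le> real L * (\<Sum>j<L. 16 * B\<^sup>2 * variance_bound x q)"
    by (intro mult_left_mono sum_mono block) auto
  also have "\<dots> = 16 * (real L)\<^sup>2 * B\<^sup>2 * variance_bound x q" by (simp add: power2_eq_square)
  finally show ?thesis by (simp add: U_def n_def L_def)
qed

section \<open>The variance\<close>

definition squarefree_count :: "real \<Rightarrow> nat \<Rightarrow> nat \<Rightarrow> real" where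
  "squarefree_count x q a = (\<Sum>n | n \<in> naturals_upto x \<and> n mod q = a. real_of_int \<bar>moebius_mu n\<bar>)"

text \<open>Residues are taken in \<open>[0, q)\<close> while totatives lie in
  \<open>[1, q]\<close>; the two sets differ only for \<open>q = 1\<close>, where 0 stands for
  1.\<close>

lemma card_units_eq_totient:
  assumes "q > 0"
  shows "card {a. a < q \<and> coprime a q} = totient q"
proof (cases "q = 1")
  case True
  hence "{a. a < q \<and> coprime a q} = {0}" by auto
  thus ?thesis using True by simp
next
  case False
  hence "{a. a < q \<and> coprime a q} = totatives q"
    using assms by (auto simp: totatives_def order_le_less intro!: Nat.gr0I)
  thus ?thesis by (simp add: totient_def)
qed

lemma sum_coprime_eq_sum_squarefree_count:
  assumes "q > 0"
  shows "(\<Sum>n \<in> {n. 1 \<le> n \<and> real n \<le> x \<and> gcd n q = 1}. real_of_int \<bar>moebius_mu n\<bar>)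
    = (\<Sum>a | a < q \<and> coprime a q. squarefree_count x q a)"
proof -
  let ?N = "{n. 1 \<le> n \<and> real n \<le> x \<and> gcd n q = 1}"
  have N: "?N = {n \<in> naturals_upto x. coprime n q}"
    unfolding naturals_upto_def coprime_iff_gcd_eq_1 by blast
  have "(\<Sum>n\<in>?N. real_of_int \<bar>moebius_mu n\<bar>)
      = (\<Sum>a\<in>{a. a < q \<and> coprime a q}. \<Sum>n\<in>{n \<in> ?N. n mod q = a}. real_of_int \<bar>moebius_mu n\<bar>)"
    unfolding N using assms by (intro sum.group[symmetric]) auto
  also have "\<dots> = (\<Sum>a | a < q \<and> coprime a q. squarefree_count x q a)"
    unfolding squarefree_count_def N using assms by (intro sum.cong refl) auto
  finally show ?thesis .
qed

text \<open>Coprimality to \<open>q\<close> depends only on the residue, so the pairs with common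
  residue \<open>a\<close> form a full square.\<close>

lemma T_eq_sum_squares:
  assumes "q > 0"
  shows "T x q = (\<Sum>a | a < q \<and> coprime a q. (squarefree_count x q a)\<^sup>2)"
proof -
  define N where "N = {n \<in> naturals_upto x. coprime n q}"
  define f where "f = (\<lambda>n. real_of_int \<bar>moebius_mu n\<bar>)"
  define P where "P = {(n1, n2). n1 \<in> N \<and> n2 \<in> N \<and> n1 mod q = n2 mod q}"
  have finN: "finite N" by (simp add: N_def)
  have finP: "finite P" by (rule finite_subset[of _ "N \<times> N"]) (use finN in \<open>auto simp: P_def\<close>)
  have "T x q = (\<Sum>(n1, n2)\<in>P. f n1 * f n2)"
    unfolding T_def
  proof (rule sum.cong)
    have "gcd (n1 * n2) q = 1 \<longleftrightarrow> coprime n1 q \<and> coprime n2 q" for n1 n2 :: nat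
      unfolding coprime_iff_gcd_eq_1[symmetric] by (rule coprime_mult_left_iff)
    note cop = this
    show "{(n1, n2). 1 \<le> n1 \<and> real n1 \<le> x \<and> 1 \<le> n2 \<and> real n2 \<le> x \<and>
        gcd (n1 * n2) q = 1 \<and> [n1 = n2] (mod q)} = P"
      unfolding P_def N_def naturals_upto_def cop unique_euclidean_semiring_class.cong_def mem_Collect_eq
      by (simp only: conj_ac)
  qed (auto simp: f_def)
  also have "\<dots> = (\<Sum>a\<in>{a. a < q \<and> coprime a q}. \<Sum>p\<in>{p \<in> P. fst p mod q = a}. case p of (n1, n2) \<Rightarrow> f n1 * f n2)"
    using assms finP by (intro sum.group[symmetric]) (auto simp: P_def N_def)
  also have "\<dots> = (\<Sum>a | a < q \<and> coprime a q. (squarefree_count x q a)\<^sup>2)"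
  proof (rule sum.cong[OF refl])
    fix a assume "a \<in> {a. a < q \<and> coprime a q}"
    hence a: "coprime a q" by simp
    let ?A = "{n. n \<in> naturals_upto x \<and> n mod q = a}"
    have cop: "coprime n q" if "n mod q = a" for n
      using a assms unfolding that[symmetric] by simp
    have "{p \<in> P. fst p mod q = a} = ?A \<times> ?A" using cop by (auto simp: P_def N_def)
    thus "(\<Sum>p\<in>{p \<in> P. fst p mod q = a}. case p of (n1, n2) \<Rightarrow> f n1 * f n2) = (squarefree_count x q a)\<^sup>2"
      by (simp only: sum.cartesian_product[symmetric] sum_product[symmetric] squarefree_count_def
          f_def power2_eq_square)
  qed
  finally show ?thesis .
qed

text \<open>The Moebius identity is inserted and the pairs \<open>(n, d)\<close> are reparametrised
  by \<open>n = d\<^sup>2 * m\<close>. As \<open>n\<close> is congruent to a unit, \<open>d\<close>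
  is coprime to \<open>q\<close>, and \<open>m \<ge> 1\<close> gives
  \<open>d\<^sup>2 \<le> x\<close>.\<close>

lemma squarefree_count_eq:
  assumes q: "q > 0" and a: "coprime a q"
    and D: "\<And>d. d \<in> D \<longleftrightarrow> d > 0 \<and> coprime d q \<and> (real d)\<^sup>2 \<le> x"
  defines "I \<equiv> Sigma D (\<lambda>d. naturals_upto (x / (real d)\<^sup>2))"
  shows "squarefree_count x q a
    = (\<Sum>i | i \<in> I \<and> (case i of (d, m) \<Rightarrow> d\<^sup>2 * m) mod q = a. real_of_int (moebius_mu (fst i)))"
proof -
  let ?A = "{n. n \<in> naturals_upto x \<and> n mod q = a}"
  have fin: "finite ?A" "finite {d. d\<^sup>2 dvd n}" if "n \<in> ?A" for n
  proof -
    have "n > 0" using that by (simp add: naturals_upto_def)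
    have "{d. d\<^sup>2 dvd n} \<subseteq> {d. d dvd n}" by (auto intro: dvd_trans[OF dvd_power[of 2]])
    thus "finite {d. d\<^sup>2 dvd n}" by (rule finite_subset) (use \<open>n > 0\<close> in simp)
  qed auto
  have finA: "finite ?A" by simp
  have "squarefree_count x q a = (\<Sum>n\<in>?A. \<Sum>d\<in>{d. d\<^sup>2 dvd n}. real_of_int (moebius_mu d))"
    unfolding squarefree_count_def
    by (intro sum.cong refl) (simp add: abs_moebius_mu_eq_sum naturals_upto_def)
  also have "\<dots> = (\<Sum>(n, d)\<in>Sigma ?A (\<lambda>n. {d. d\<^sup>2 dvd n}). real_of_int (moebius_mu d))"
    using fin finA by (intro sum.Sigma) auto
  also have "\<dots> = (\<Sum>i | i \<in> I \<and> (case i of (d, m) \<Rightarrow> d\<^sup>2 * m) mod q = a. real_of_int (moebius_mu (fst i)))"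
  proof (rule sum.reindex_bij_witness[of _ "\<lambda>(d, m). (d\<^sup>2 * m, d)" "\<lambda>(n, d). (d, n div d\<^sup>2)"], goal_cases)
    case (2 p)
    obtain n d where p: "p = (n, d)" by (cases p)
    with 2 obtain m where m: "n = d\<^sup>2 * m" by (auto elim: dvdE)
    have n: "n > 0" "real n \<le> x" "n mod q = a" using 2 by (auto simp: p naturals_upto_def)
    hence pos: "d > 0" "m > 0" by (auto simp: m)
    have "coprime n q" using a q n(3) by (metis coprime_mod_left_iff less_not_refl)
    hence "coprime d q" by (simp add: m)
    have "(real d)\<^sup>2 * real m \<le> x" using n(2) by (simp add: m)
    moreover have "(real d)\<^sup>2 * 1 \<le> (real d)\<^sup>2 * real m" using pos by (intro mult_left_mono) auto
    ultimately have "(real d)\<^sup>2 \<le> x" by linarith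
    moreover have "real m \<le> x / (real d)\<^sup>2"
      using pos \<open>(real d)\<^sup>2 * real m \<le> x\<close> by (simp add: le_divide_eq mult.commute)
    ultimately show ?case using pos n(3) \<open>coprime d q\<close> by (simp add: p m I_def D naturals_upto_def)
  next
    case (3 i)
    thus ?case by (auto simp: I_def D)
  next
    case (4 i)
    obtain d m where i: "i = (d, m)" by (cases i)
    have d: "d > 0" "m \<in> naturals_upto (x / (real d)\<^sup>2)" "d\<^sup>2 * m mod q = a" using 4 by (auto simp: i I_def D)
    have "real (d\<^sup>2 * m) \<le> x" using d by (simp add: naturals_upto_def le_divide_eq mult.commute)
    thus ?case using d by (auto simp: i naturals_upto_def)
  qed auto
  finally show ?thesis .
qed

text \<open>The left-hand side is the sum of squared deviations from the mean, hence nonnegative,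
  and the mean minimises that sum. So \<open>c\<close> may be an average over all residues instead
  of over the units.\<close>

lemma sum_squares_minus_mean_le:
  fixes S :: "'a \<Rightarrow> real"
  assumes "finite U" "U \<noteq> {}"
  shows "\<bar>(\<Sum>a\<in>U. (S a)\<^sup>2) - 1 / card U * (\<Sum>a\<in>U. S a)\<^sup>2\<bar> \<le> (\<Sum>a\<in>U. (S a - c)\<^sup>2)"
proof -
  define N where "N = real (card U)"
  define m where "m = (\<Sum>a\<in>U. S a) / N"
  have N: "N > 0" using assms by (simp add: N_def card_gt_0_iff)
  have m: "(\<Sum>a\<in>U. S a) = N * m" using N by (simp add: m_def)
  have expand: "(\<Sum>a\<in>U. (S a - c)\<^sup>2) = (\<Sum>a\<in>U. (S a)\<^sup>2) - N * m\<^sup>2 + N * (c - m)\<^sup>2" for c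
  proof -
    have "(\<Sum>a\<in>U. (S a - c)\<^sup>2) = (\<Sum>a\<in>U. (S a)\<^sup>2 - 2 * c * S a + c\<^sup>2)"
      by (intro sum.cong refl) (simp add: power2_diff)
    also have "\<dots> = (\<Sum>a\<in>U. (S a)\<^sup>2) - 2 * c * (N * m) + N * c\<^sup>2"
      by (simp only: sum.distrib sum_subtractf sum_distrib_left[symmetric] m) (simp add: N_def)
    finally show ?thesis by (simp add: power2_eq_square algebra_simps)
  qed
  have "1 / card U * (\<Sum>a\<in>U. S a)\<^sup>2 = N * m\<^sup>2"
    using N unfolding m N_def[symmetric] by (simp add: power2_eq_square)
  moreover have "0 \<le> (\<Sum>a\<in>U. (S a - m)\<^sup>2)" by (intro sum_nonneg) auto
  moreover have "0 \<le> N * (c - m)\<^sup>2" using N by simp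
  ultimately show ?thesis using expand[of m] expand[of c] by simp
qed

lemma dyadic_count_le_powr:
  fixes \<delta> :: real
  assumes "\<delta> > 0" "x \<ge> 1"
  shows "real (dyadic_count x) \<le> (1 + 2 / \<delta>) * x powr \<delta>"
proof -
  let ?n = "nat \<lfloor>x\<rfloor>" let ?k = "floor_log ?n"
  have n: "?n > 0" "real ?n \<le> x" using assms by auto
  have "2 ^ ?k \<le> x" using floor_log_eq_bounds(1)[OF refl n(1)] n(2) by linarith
  have "real (?k + 1) \<le> (1 + 2 / \<delta>) * 2 powr (\<delta> * ?k)" by (rule Suc_le_const_mult_powr[OF assms(1)])
  also have "2 powr (\<delta> * ?k) = (2 ^ ?k) powr \<delta>"
    by (simp add: powr_powr mult.commute flip: powr_realpow)
  also have "(1 + 2 / \<delta>) * \<dots> \<le> (1 + 2 / \<delta>) * x powr \<delta>"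
    using assms \<open>2 ^ ?k \<le> x\<close> by (intro mult_left_mono powr_mono2) auto
  finally show ?thesis by (simp add: dyadic_count_def)
qed

lemma variance_le:
  fixes x B :: real
  assumes q: "q > 0" "real q \<le> x"
    and B: "\<And>n. 1 \<le> n \<Longrightarrow> real n \<le> 4 * x\<^sup>2 \<Longrightarrow> real (card {d. d dvd n}) \<le> B"
  shows "\<bar>T x q - 1 / real (totient q) *
      (\<Sum>n \<in> {n. 1 \<le> n \<and> real n \<le> x \<and> gcd n q = 1}. real_of_int \<bar>moebius_mu n\<bar>) ^ 2\<bar>
    \<le> 544 * real (dyadic_count x) ^ 4 * B ^ 3 * variance_bound x q"
proof -
  define L where "L = real (dyadic_count x)"
  define U where "U = {a. a < q \<and> coprime a q}"
  define D where "D = {d. d > 0 \<and> coprime d q \<and> (real d)\<^sup>2 \<le> x}"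
  define D1 where "D1 = {d \<in> D. (real d)\<^sup>2 * sqrt q \<le> x}"
  define D2 where "D2 = {d \<in> D. \<not> (real d)\<^sup>2 * sqrt q \<le> x}"
  define I where "I = (\<lambda>D. Sigma D (\<lambda>d. naturals_upto (x / (real d)\<^sup>2)))"
  define c where "c = (\<lambda>d. real_of_int (moebius_mu d))"
  define S where "S = (\<lambda>D a. \<Sum>i | i \<in> I D \<and> (case i of (d, m) \<Rightarrow> d\<^sup>2 * m) mod q = a. c (fst i))"
  \<comment> \<open>The average of the small-divisor part over all \<open>q\<close> residues, as
    required by the Parseval step.\<close>
  define \<mu> where "\<mu> = (\<Sum>i\<in>I D1. c (fst i)) / q"
  have "1 \<le> real q" using q by simp
  hence x: "x \<ge> 1" using q by linarith
  have "1 \<le> x\<^sup>2" using x by (rule one_le_power)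
  hence B1: "B \<ge> 1" using B[of 1] by simp
  have c: "\<bar>c d\<bar> \<le> 1" for d
    using abs_moebius_mu_le_1[of d] unfolding c_def by linarith
  have E: "variance_bound x q \<ge> 0" using x by (intro variance_bound_nonneg) auto
  have L1: "L \<ge> 1" by (simp add: L_def dyadic_count_def)
  have "D \<subseteq> naturals_upto x"
  proof
    fix d assume d: "d \<in> D"
    hence "real d * 1 \<le> real d * real d" by (intro mult_left_mono) (auto simp: D_def)
    moreover have "real d * real d \<le> x" using d by (auto simp: D_def power2_eq_square)
    ultimately have "real d \<le> x" by linarith
    thus "d \<in> naturals_upto x" using d by (auto simp: D_def naturals_upto_def)
  qed
  hence fin: "finite D" by (rule finite_subset) simp
  have fin': "finite D1" "finite D2" using fin by (simp_all add: D1_def D2_def)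
  have finI: "finite (I E)" if "E \<subseteq> D" for E
    unfolding I_def using fin that by (intro finite_SigmaI) (auto intro: finite_subset)
  have split: "S D a = S D1 a + S D2 a" for a
  proof -
    have "{i. i \<in> I D \<and> (case i of (d, m) \<Rightarrow> d\<^sup>2 * m) mod q = a}
        = {i. i \<in> I D1 \<and> (case i of (d, m) \<Rightarrow> d\<^sup>2 * m) mod q = a}
          \<union> {i. i \<in> I D2 \<and> (case i of (d, m) \<Rightarrow> d\<^sup>2 * m) mod q = a}"
      by (auto simp: I_def D1_def D2_def)
    thus ?thesis unfolding S_def
      by (simp only:) (intro sum.union_disjoint; use finI in \<open>auto simp: I_def D1_def D2_def\<close>)
  qed
  have finU: "finite U" by (simp add: U_def)
  have card_U: "card U = totient q" unfolding U_def by (rule card_units_eq_totient[OF q(1)])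
  have U_ne: "U \<noteq> {}" using card_U q(1) by auto
  have count: "squarefree_count x q a = S D a" if "a \<in> U" for a
    unfolding S_def I_def c_def using that q(1)
    by (intro squarefree_count_eq) (auto simp: U_def D_def)
  have "\<bar>(\<Sum>a\<in>U. (squarefree_count x q a)\<^sup>2) - 1 / card U * (\<Sum>a\<in>U. squarefree_count x q a)\<^sup>2\<bar>
      \<le> (\<Sum>a\<in>U. (squarefree_count x q a - \<mu>)\<^sup>2)"
    by (rule sum_squares_minus_mean_le[OF finU U_ne])
  also have "\<dots> \<le> (\<Sum>a\<in>U. 2 * (S D1 a - \<mu>)\<^sup>2 + 2 * (S D2 a)\<^sup>2)"
  proof (rule sum_mono)
    fix a assume a: "a \<in> U"
    have "(squarefree_count x q a - \<mu>)\<^sup>2 = ((S D1 a - \<mu>) + S D2 a)\<^sup>2"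
      unfolding count[OF a] split by (simp add: algebra_simps)
    also have "\<dots> \<le> 2 * (S D1 a - \<mu>)\<^sup>2 + 2 * (S D2 a)\<^sup>2"
      using sum_squares_bound[of "S D1 a - \<mu>" "S D2 a"] unfolding power2_sum by linarith
    finally show "(squarefree_count x q a - \<mu>)\<^sup>2 \<le> 2 * (S D1 a - \<mu>)\<^sup>2 + 2 * (S D2 a)\<^sup>2" .
  qed
  also have "\<dots> = 2 * (\<Sum>a\<in>U. (S D1 a - \<mu>)\<^sup>2) + 2 * (\<Sum>a\<in>U. (S D2 a)\<^sup>2)"
    by (simp only: sum.distrib sum_distrib_left)
  also have "\<dots> \<le> 2 * (256 * L ^ 4 * B ^ 3 * variance_bound x q) + 2 * (16 * L\<^sup>2 * B\<^sup>2 * variance_bound x q)"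
  proof (intro add_mono mult_left_mono)
    \<comment> \<open>Squares are nonnegative, so the sum may be extended from units to all
      residues.\<close>
    have "(\<Sum>a\<in>U. (S D1 a - \<mu>)\<^sup>2) \<le> (\<Sum>a<q. (S D1 a - \<mu>)\<^sup>2)"
      by (intro sum_mono2) (auto simp: U_def)
    also have "\<dots> \<le> 256 * L ^ 4 * B ^ 3 * variance_bound x q"
      unfolding S_def \<mu>_def I_def L_def using q fin'(1) B c
      by (intro variance_small_divisors_le) (auto simp: D1_def D_def)
    finally show "(\<Sum>a\<in>U. (S D1 a - \<mu>)\<^sup>2) \<le> 256 * L ^ 4 * B ^ 3 * variance_bound x q" .
    show "(\<Sum>a\<in>U. (S D2 a)\<^sup>2) \<le> 16 * L\<^sup>2 * B\<^sup>2 * variance_bound x q"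
      unfolding S_def I_def L_def U_def using q fin'(2) B c
      by (intro second_moment_large_divisors_le) (auto simp: D2_def D_def)
  qed auto
  \<comment> \<open>Here 544 is 2 * 256 + 2 * 16.\<close>
  also have "\<dots> \<le> 544 * L ^ 4 * B ^ 3 * variance_bound x q"
  proof -
    have "L\<^sup>2 * B\<^sup>2 \<le> L ^ 4 * B ^ 3"
      using L1 B1 by (intro mult_mono power_increasing) auto
    hence "L\<^sup>2 * B\<^sup>2 * variance_bound x q \<le> L ^ 4 * B ^ 3 * variance_bound x q"
      using E by (rule mult_right_mono)
    thus ?thesis by linarith
  qed
  finally show ?thesis
    unfolding T_eq_sum_squares[OF q(1)] sum_coprime_eq_sum_squarefree_count[OF q(1)]
    by (simp only: U_def[symmetric] card_U L_def)
qed

theorem proposition1: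
  fixes \<epsilon> :: real
  assumes "\<epsilon> > 0"
  shows "\<exists>C::real. C > 0 \<and>
    (\<forall>(x::real) (q::nat). x \<ge> 1 \<longrightarrow> q \<ge> 1 \<longrightarrow> real q \<le> x \<longrightarrow>
      \<bar>T x q - 1 / real (totient q) *
          (\<Sum>n \<in> {n::nat. 1 \<le> n \<and> real n \<le> x \<and> gcd n q = 1}.
             real_of_int \<bar>moebius_mu n\<bar>) ^ 2\<bar>
        \<le> C * (x powr \<epsilon> *
            (x powr (1 / 2) * real q powr (1 / 2) + x / real q powr (1 / 2))))"
proof -
  \<comment> \<open>The dyadic count enters to the fourth power with exponent
    \<open>\<delta>\<close>, and \<open>B\<close> cubed with exponent \<open>2 * \<delta>\<close>;
    together they use \<open>10 * \<delta>\<close>.\<close>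
  define \<delta> where "\<delta> = \<epsilon> / 10"
  have \<delta>: "\<delta> > 0" using assms by (simp add: \<delta>_def)
  obtain C0 where C0: "C0 \<ge> 1" "\<And>n::nat. n > 0 \<Longrightarrow> real (card {d. d dvd n}) \<le> C0 * real n powr \<delta>"
    using divisor_bound[OF \<delta>] by blast
  define K where "K = 1 + 2 / \<delta>"
  \<comment> \<open>The factor \<open>4 powr \<delta>\<close> absorbs the 4 in the range
    \<open>4 * x\<^sup>2\<close> of the divisor bound.\<close>
  define C1 where "C1 = C0 * 4 powr \<delta>"
  define C where "C = 544 * K ^ 4 * C1 ^ 3"
  have pos: "K > 0" "C1 > 0" using C0 \<delta> by (auto simp: K_def C1_def add_pos_pos)
  show ?thesis
  proof (intro exI[of _ C] conjI allI impI)
    show "C > 0" using pos by (simp add: C_def)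
    fix x :: real and q :: nat
    assume x: "x \<ge> 1" and q: "q \<ge> 1" "real q \<le> x"
    define B where "B = C1 * x powr (2 * \<delta>)"
    have E: "variance_bound x q \<ge> 0" using x by (intro variance_bound_nonneg) auto
    have "\<bar>T x q - 1 / real (totient q) *
        (\<Sum>n \<in> {n. 1 \<le> n \<and> real n \<le> x \<and> gcd n q = 1}. real_of_int \<bar>moebius_mu n\<bar>) ^ 2\<bar>
      \<le> 544 * real (dyadic_count x) ^ 4 * B ^ 3 * variance_bound x q"
    proof (rule variance_le)
      fix n :: nat assume n: "1 \<le> n" "real n \<le> 4 * x\<^sup>2"
      have "real (card {d. d dvd n}) \<le> C0 * real n powr \<delta>" using n by (intro C0) auto
      also have "\<dots> \<le> C0 * (4 * x\<^sup>2) powr \<delta>"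
        using n \<delta> C0 by (intro mult_left_mono powr_mono2) auto
      also have "(4 * x\<^sup>2) powr \<delta> = 4 powr \<delta> * (x powr 2) powr \<delta>"
        using x by (simp add: powr_mult)
      also have "C0 * \<dots> = B" by (simp add: B_def C1_def powr_powr)
      finally show "real (card {d. d dvd n}) \<le> B" .
    qed (use q in auto)
    also have "\<dots> \<le> 544 * (K * x powr \<delta>) ^ 4 * B ^ 3 * variance_bound x q"
      using dyadic_count_le_powr[OF \<delta> x] pos E unfolding K_def[symmetric] B_def
      by (intro mult_right_mono mult_left_mono power_mono) auto
    also have "\<dots> = C * ((x powr \<delta>) ^ 4 * (x powr (2 * \<delta>)) ^ 3 * variance_bound x q)"
      by (simp add: C_def B_def power_mult_distrib mult_ac)
    also have "(x powr \<delta>) ^ 4 * (x powr (2 * \<delta>)) ^ 3 = x powr \<epsilon>"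
      using x by (simp add: powr_power \<delta>_def flip: powr_add)
    also have "variance_bound x q = x powr (1 / 2) * real q powr (1 / 2) + x / real q powr (1 / 2)"
      using x by (simp add: variance_bound_def powr_half_sqrt real_sqrt_mult)
    finally show "\<bar>T x q - 1 / real (totient q) *
        (\<Sum>n \<in> {n. 1 \<le> n \<and> real n \<le> x \<and> gcd n q = 1}. real_of_int \<bar>moebius_mu n\<bar>) ^ 2\<bar>
      \<le> C * (x powr \<epsilon> * (x powr (1 / 2) * real q powr (1 / 2) + x / real q powr (1 / 2)))" .
  qed
qed

end
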